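(* The radical equivalence classes of $I_{\mathcal C_{\mathcal A}}$ form a polyhedral fan that coincides with the secondary fan of $I_{\mathcal A}$.
   Context: Setting: $\mathcal A=\{\mathbf a_1,\dots,\mathbf a_n\}\subset\mathbb{Z}^d$ is an ordered vector configuration such that the $d\times n$ matrix $A=[\mathbf a_1\cdots\mathbf a_n]$ has rank $d$; $\mathcal L_{\mathcal A}=\{\mathbf u\in\mathbb{Z}^n: A\mathbf u=\mathbf 0\}$, and it is assumed that $\mathcal L_{\mathcal A}\cap\mathbb{N}^n=\{\mathbf 0\}$ ($\mathbb N$ contains $0$). $\mathbf k$ is an algebraically closed field, $\mathbf k[\mathbf x]=\mathbf k[x_1,\dots,x_n]$. For $\mathbf u\in\mathbb{Z}^n$: $\mathrm{supp}(\mathbf u)=\{i:u_i\ne0\}$, $\mathbf u^+_i=\max(u_i,0)$, $\mathbf u^-_i=\max(-u_i,0)$. Circuit: a non-zero vector $\mathbf c\in\mathcal L_{\mathcal A}$ whose entries have greatest common divisor one and such that no non-zero $\mathbf d\in\mathcal L_{\mathcal A}$ has $\mathrm{supp}(\mathbf d)\subsetneq\mathrm{supp}(\mathbf c)$. Circuit ideal: $I_{\mathcal C_{\mathcal A}}=\langle\mathbf x^{\mathbf c^+}-\mathbf x^{\mathbf c^-}:\mathbf c\text{ a circuit}\rangle$. Toric ideal: $I_{\mathcal A}=\langle\mathbf x^{\mathbf u^+}-\mathbf x^{\mathbf u^-}:\mathbf u\in\mathcal L_{\mathcal A}\rangle$. Initial ideals: for $\omega\in\mathbb{R}^n$, $\mathrm{in}_\omega(f)$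 is the sum of the terms $c\,\mathbf x^{\mathbf u}$ of $f$ with $\omega\cdot\mathbf u$ maximal, and $\mathrm{in}_\omega(I)=\langle\mathrm{in}_\omega(f):f\in I\rangle$. Radical equivalence relation of an ideal $I$ (homogeneous with respect to some strictly positive integer grading vector): on $\mathbb{R}^n$, $\mathbf u\sim\mathbf v\Leftrightarrow\sqrt{\mathrm{in}_{\mathbf u}(I)}=\sqrt{\mathrm{in}_{\mathbf v}(I)}$. An equivalence relation on $\mathbb{R}^n$ defines (its classes form) a fan $F$ if the closures of its equivalence classes are exactly the cones of $F$. A fan is a collection of polyhedral cones closed under taking faces such that the intersection of any two of them is a face of each. The secondary fan of $I_{\mathcal A}$ (also called the secondary fan of $\mathcal A$) is the fan defined by the radical equivalence relation of $I_{\mathcal A}$ (it is a known result that this relation defines a fan). *)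

theory Defs
  imports
    "HOL-Analysis.Analysis"
    "HOL-Library.Poly_Mapping"
    "HOL-Computational_Algebra.Polynomial"
begin

text \<open>Elements of \<open>k[x_i : i \<in> 'n]\<close>, as finitely supported functions from exponent vectors to
  coefficients; multiplication of \<^type>\<open>poly_mapping\<close> is convolution over exponents.\<close>

type_synonym ('k, 'n) polyring = "(nat ^ 'n) \<Rightarrow>\<^sub>0 'k"

definition ideal_gen :: "'a::comm_ring_1 set \<Rightarrow> 'a set" where
  "ideal_gen B = {\<Sum>b\<in>T. q b * b | T q. finite T \<and> T \<subseteq> B}"

definition radical_ideal :: "'a::comm_ring_1 set \<Rightarrow> 'a set" where
  "radical_ideal I = {f. \<exists>m>0. f ^ m \<in> I}"

definition weight :: "real ^ 'n \<Rightarrow> nat ^ 'n \<Rightarrow> real" where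
  "weight \<omega> u = (\<Sum>i\<in>UNIV. \<omega> $ i * real (u $ i))"

definition initial_form ::
  "real ^ 'n \<Rightarrow> ('k::comm_ring_1, 'n::finite) polyring \<Rightarrow> ('k, 'n) polyring" where
  "initial_form \<omega> f =
     (\<Sum>u\<in>{u \<in> Poly_Mapping.keys f. \<forall>v\<in>Poly_Mapping.keys f. weight \<omega> v \<le> weight \<omega> u}.
        Poly_Mapping.single u (Poly_Mapping.lookup f u))"

definition initial_ideal ::
  "real ^ 'n \<Rightarrow> ('k::comm_ring_1, 'n::finite) polyring set \<Rightarrow> ('k, 'n) polyring set" where
  "initial_ideal \<omega> I = ideal_gen (initial_form \<omega> ` I)"

text \<open>A vector configuration is given by its matrix \<open>A\<close>, whose columns \<open>column i A\<close> are
  the vectors \<open>a_i\<close>.\<close>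

definition lattice_of :: "int ^ 'n ^ 'd \<Rightarrow> (int ^ 'n) set" where
  "lattice_of A = {u. A *v u = 0}"

definition supp :: "int ^ 'n \<Rightarrow> 'n set" where
  "supp u = {i. u $ i \<noteq> 0}"

definition pos_part :: "int ^ 'n \<Rightarrow> nat ^ 'n" where
  "pos_part u = (\<chi> i. nat (max (u $ i) 0))"

definition neg_part :: "int ^ 'n \<Rightarrow> nat ^ 'n" where
  "neg_part u = (\<chi> i. nat (max (- u $ i) 0))"

definition binomial_of :: "int ^ 'n \<Rightarrow> ('k::comm_ring_1, 'n::finite) polyring" where
  "binomial_of u = Poly_Mapping.single (pos_part u) 1 - Poly_Mapping.single (neg_part u) 1"

definition is_circuit :: "int ^ 'n ^ 'd \<Rightarrow> int ^ 'n \<Rightarrow> bool" where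
  "is_circuit A c \<longleftrightarrow>
     c \<in> lattice_of A \<and> c \<noteq> 0 \<and> (GCD i\<in>UNIV. c $ i) = 1 \<and>
     \<not> (\<exists>d\<in>lattice_of A. d \<noteq> 0 \<and> supp d \<subset> supp c)"

definition toric_ideal :: "int ^ 'n ^ 'd \<Rightarrow> ('k::comm_ring_1, 'n::finite) polyring set" where
  "toric_ideal A = ideal_gen (binomial_of ` lattice_of A)"

definition circuit_ideal :: "int ^ 'n ^ 'd \<Rightarrow> ('k::comm_ring_1, 'n::finite) polyring set" where
  "circuit_ideal A = ideal_gen (binomial_of ` {c. is_circuit A c})"

definition polyhedral_cone :: "'a::euclidean_space set \<Rightarrow> bool" where
  "polyhedral_cone C \<longleftrightarrow> polyhedron C \<and> convex_cone C"

text \<open>The empty set satisfies \<open>{} face_of C\<close> in the library, but is not a face of a cone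
  in the sense of fans; hence the side condition \<open>D \<noteq> {}\<close>. Polyhedral cones contain \<open>0\<close>,
  so intersections of cones are never empty.\<close>

definition is_fan :: "'a::euclidean_space set set \<Rightarrow> bool" where
  "is_fan F \<longleftrightarrow>
     (\<forall>C\<in>F. polyhedral_cone C) \<and>
     (\<forall>C\<in>F. \<forall>D. D face_of C \<and> D \<noteq> {} \<longrightarrow> D \<in> F) \<and>
     (\<forall>C\<in>F. \<forall>D\<in>F. (C \<inter> D) face_of C \<and> (C \<inter> D) face_of D)"

definition class_closures :: "('a::topological_space \<times> 'a) set \<Rightarrow> 'a set set" where
  "class_closures R = closure ` (UNIV // R)"

definition defines_fan :: "('a::euclidean_space \<times> 'a) set \<Rightarrow> 'a set set \<Rightarrow> bool" where
  "defines_fan R F \<longleftrightarrow> equiv UNIV R \<and> is_fan F \<and> class_closures R = F"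

definition radical_equiv ::
  "('k::comm_ring_1, 'n::finite) polyring set \<Rightarrow> ((real ^ 'n) \<times> (real ^ 'n)) set" where
  "radical_equiv I =
     {(u, v). radical_ideal (initial_ideal u I) = radical_ideal (initial_ideal v I)}"

text \<open>The only collection of cones that the radical equivalence relation of the toric ideal
  can define is that of its class closures, so it is taken as the secondary fan. That it is
  a fan is not part of this definition. The argument of type \<open>'k itself\<close> records
  the coefficient field of the toric ideal.\<close>

definition secondary_fan ::
  "'k::comm_ring_1 itself \<Rightarrow> int ^ 'n::finite ^ 'd \<Rightarrow> (real ^ 'n) set set" where
  "secondary_fan _ A = class_closures (radical_equiv (toric_ideal A :: ('k, 'n) polyring set))"

end

theory Submission
  imports Defs
begin

text \<open>
  The theorem has two halves. The algebraic half says that passing from the circuit ideal to the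
  toric ideal does not change the radical of any initial ideal, so both ideals have the same
  radical equivalence relation. The geometric half says that this relation defines a fan.

  \<^bold>\<open>The radical equivalences agree.\<close> The toric ideal \<open>I\<close> lies in the radical of the circuit ideal
  \<open>C\<close> (\<open>toric_ideal_subset_radical\<close>). It is enough to put each binomial of the lattice into every
  prime \<open>P\<close> containing \<open>C\<close>. Modulo \<open>P\<close> some variables are zero and the others, indexed by \<open>S\<close>,
  are nonzero in a domain. For \<open>u\<close> supported in \<open>S\<close> the claim holds since the circuits supported
  in \<open>S\<close> generate, over the integers, the sublattice supported in \<open>S\<close>
  (\<open>circuits_generate_lattice\<close>). For other \<open>u\<close> a circuit conformal to \<open>u\<close>
  (\<open>conformal_circuit\<close>) shows that both monomials of the binomial vanish. Once some power of
  \<open>f \<in> I\<close> lies in \<open>C\<close>, the same power of the initial form of \<open>f\<close> lies in the initial ideal of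
  \<open>C\<close>, because the top-weight part of a power is the power of the top-weight part.

  \<^bold>\<open>The equivalence is combinatorial.\<close> A weight \<open>\<omega>\<close> induces a regular subdivision of the
  configuration. A set \<open>\<sigma>\<close> of indices is contained in a cell exactly when every nonnegative
  vector supported in \<open>\<sigma>\<close> is cheapest for \<open>\<omega>\<close> in its fibre, i.e. among the nonnegative vectors
  with the same image under \<open>A\<close>. Two radicals of initial ideals of \<open>I\<close> agree iff these
  families \<open>subcells A \<omega>\<close> agree (\<open>radical_initial_toric_ideal_eq_iff\<close>): a squarefree monomial
  lies in the radical iff its support is not in a cell, and modulo these monomials the initial
  form of an element of \<open>I\<close> is a combination of binomials of constant weight.

  \<^bold>\<open>The classes form a fan.\<close> The closure of the class of \<open>\<theta>\<close> is the cone of all \<open>x\<close> with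
  \<open>subcells A \<theta> \<subseteq> subcells A x\<close>, that is, of all \<open>x\<close> whose subdivision is refined by that of
  \<open>\<theta>\<close>. Everything follows from the identity \<open>subcells A (x + y) = subcells A x \<inter> subcells A y\<close> for
  \<open>x\<close>, \<open>y\<close> in one such cone (\<open>subcells_add\<close>). It holds since the cells of the subdivision of
  \<open>\<theta>\<close> cover: each fibre contains, up to a multiple, a vector supported in a cell
  (\<open>exists_optimum\<close>), and that vector is then cheapest for \<open>x\<close>, for \<open>y\<close> and for \<open>x + y\<close>.
\<close>

section \<open>Circuits of the kernel lattice\<close>

lemma lattice_0 [simp]: "0 \<in> lattice_of A"
  by (simp add: lattice_of_def)

lemma lattice_add: "u \<in> lattice_of A \<Longrightarrow> v \<in> lattice_of A \<Longrightarrow> u + v \<in> lattice_of A"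
  by (simp add: lattice_of_def matrix_vector_right_distrib)

lemma lattice_diff: "u \<in> lattice_of A \<Longrightarrow> v \<in> lattice_of A \<Longrightarrow> u - v \<in> lattice_of A"
  by (simp add: lattice_of_def matrix_vector_mult_diff_distrib)

lemma lattice_uminus: "u \<in> lattice_of A \<Longrightarrow> - u \<in> lattice_of A"
  using lattice_diff[of 0 A u] by simp

lemma matrix_vector_mult_smult: "(A :: int ^ 'n ^ 'd) *v (c *s u) = c *s (A *v u)"
  by (simp add: vec_eq_iff matrix_vector_mult_def sum_distrib_left mult.left_commute)

lemma lattice_smult: "u \<in> lattice_of A \<Longrightarrow> c *s u \<in> lattice_of A"
  by (simp add: lattice_of_def matrix_vector_mult_smult)

lemma lattice_smult_cancel: "c *s u \<in> lattice_of A \<Longrightarrow> c \<noteq> 0 \<Longrightarrow> u \<in> lattice_of A"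
  by (simp add: lattice_of_def matrix_vector_mult_smult vec_eq_iff)

lemma mem_supp [simp]: "i \<in> supp u \<longleftrightarrow> u $ i \<noteq> 0"
  by (simp add: supp_def)

lemma supp_uminus [simp]: "supp (- u) = supp u"
  by (simp add: supp_def)

lemma supp_smult: "supp (c *s u) = (if c = 0 then {} else supp u)"
  by (auto simp: supp_def)

lemma is_circuitD:
  assumes "is_circuit A c"
  shows "c \<in> lattice_of A" "c \<noteq> 0" "(GCD i\<in>UNIV. c $ i) = 1"
    and "\<And>d. d \<in> lattice_of A \<Longrightarrow> supp d \<subset> supp c \<Longrightarrow> d = 0"
  using assms by (auto simp: is_circuit_def)

lemma Gcd_smult: "(GCD i\<in>UNIV. (k *s v) $ i) = \<bar>k\<bar> * (GCD i\<in>UNIV. (v :: int ^ 'n) $ i)"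
proof -
  have "(GCD i\<in>UNIV. (k *s v) $ i) = Gcd ((*) k ` range (($) v))"
    by (simp add: image_image)
  also have "\<dots> = normalize (k * (GCD i\<in>UNIV. v $ i))"
    by (rule Gcd_mult)
  finally show ?thesis by (simp add: abs_mult)
qed

lemma is_circuit_uminus:
  assumes "is_circuit A c" shows "is_circuit A (- c)"
proof -
  have "- c = (- 1) *s c" by (simp add: vec_eq_iff)
  hence "(GCD i\<in>UNIV. (- c) $ i) = (GCD i\<in>UNIV. c $ i)"
    using Gcd_smult[of "- 1" c] by simp
  with assms show ?thesis
    by (auto simp: is_circuit_def lattice_uminus)
qed

text \<open>A nonzero lattice vector of minimal support inside \<open>supp u\<close>, divided by the gcd of its entries,
is a circuit; the division stays in the lattice because a kernel is saturated.\<close>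

lemma exists_circuit:
  fixes A :: "int ^ 'n::finite ^ 'd"
  assumes u: "u \<in> lattice_of A" "u \<noteq> 0"
  shows "\<exists>c. is_circuit A c \<and> supp c \<subseteq> supp u"
proof -
  define P where "P d \<longleftrightarrow> d \<in> lattice_of A \<and> d \<noteq> 0 \<and> supp d \<subseteq> supp u" for d
  have "P u" using u by (simp add: P_def)
  then obtain d where d: "P d" and min: "\<And>e. P e \<Longrightarrow> card (supp d) \<le> card (supp e)"
    using ex_has_least_nat[of P u "\<lambda>d. card (supp d)"] by blast
  define g where "g = (GCD i\<in>UNIV. d $ i)"
  have "g \<noteq> 0"
  proof
    assume "g = 0"
    hence "range (($) d) \<subseteq> {0}" by (simp add: g_def Gcd_0_iff)
    hence "d = 0" by (auto simp: vec_eq_iff)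
    thus False using d by (simp add: P_def)
  qed
  define c where "c = (\<chi> i. d $ i div g)"
  have dc: "d = g *s c"
  proof -
    have "g dvd d $ i" for i by (simp add: g_def)
    thus ?thesis by (simp add: vec_eq_iff c_def)
  qed
  have sc: "supp c = supp d"
    using \<open>g \<noteq> 0\<close> by (simp add: dc supp_smult)
  have "\<bar>g\<bar> * (GCD i\<in>UNIV. c $ i) = g"
    using Gcd_smult[of g c] unfolding dc[symmetric] by (simp only: g_def)
  moreover have "\<bar>g\<bar> = g" by (simp add: g_def)
  ultimately have "g * (GCD i\<in>UNIV. c $ i) = g * 1" by simp
  hence "(GCD i\<in>UNIV. c $ i) = 1"
    using \<open>g \<noteq> 0\<close> by simp
  moreover have "c \<in> lattice_of A" "c \<noteq> 0"
    using d \<open>g \<noteq> 0\<close> dc by (auto simp: P_def intro: lattice_smult_cancel)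
  moreover have "e = 0" if "e \<in> lattice_of A" "supp e \<subset> supp c" for e
  proof (rule ccontr)
    assume "e \<noteq> 0"
    hence "P e" using that d sc by (auto simp: P_def)
    thus False using min that sc by (metis finite leD psubset_card_mono)
  qed
  ultimately have "is_circuit A c"
    by (auto simp: is_circuit_def)
  thus ?thesis using sc d by (auto simp: P_def)
qed

definition conformal :: "int ^ 'n \<Rightarrow> int ^ 'n \<Rightarrow> bool" where
  "conformal v u \<longleftrightarrow> (\<forall>i. v $ i \<noteq> 0 \<longrightarrow> 0 < v $ i * u $ i)"

lemma conformal_supp: "conformal v u \<Longrightarrow> supp v \<subseteq> supp u"
  by (fastforce simp: conformal_def)

lemma conformal_trans: "conformal w v \<Longrightarrow> conformal v u \<Longrightarrow> conformal w u"
  unfolding conformal_def by (smt (verit) mult_eq_0_iff zero_less_mult_iff)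

lemma conformal_nonneg: "conformal v u \<Longrightarrow> 0 \<le> u $ i \<Longrightarrow> 0 \<le> v $ i"
  unfolding conformal_def by (smt (verit) zero_less_mult_iff)

text \<open>Start at \<open>u\<close> and move in the direction \<open>- d\<close> until the first coordinate becomes zero: no coordinate
has changed sign, so the end point is conformal to \<open>u\<close> with smaller support. The end point is
scaled by \<open>p\<close> to stay integral. This step drives all inductions over supports below.\<close>

lemma conformal_reduction:
  fixes u d :: "int ^ 'n::finite"
  assumes "supp d \<subseteq> supp u" and ex: "\<exists>i. 0 < d $ i * u $ i"
  obtains p q where "0 < p" "0 < q" "conformal (p *s u - q *s d) u"
    "supp (p *s u - q *s d) \<subset> supp u"
proof -
  \<comment> \<open>\<open>r i\<close> is the time at which coordinate \<open>i\<close> reaches zero, for the coordinates in \<open>M\<close>, which move towards zero.\<close>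
  define r :: "'n \<Rightarrow> real" where "r i = \<bar>real_of_int (u $ i)\<bar> / \<bar>real_of_int (d $ i)\<bar>" for i
  define M where "M = {i. 0 < d $ i * u $ i}"
  have "M \<noteq> {}" "finite M" using ex by (auto simp: M_def)
  define i where "i = arg_min_on r M"
  have i: "i \<in> M" and min: "\<And>k. k \<in> M \<Longrightarrow> r i \<le> r k"
    using arg_min_if_finite[OF \<open>finite M\<close> \<open>M \<noteq> {}\<close>, of r] by (auto simp: i_def not_less)
  define p q where "p = \<bar>d $ i\<bar>" and "q = \<bar>u $ i\<bar>"
  have pq: "p > 0" "q > 0"
    using i by (auto simp: M_def p_def q_def)
  have key: "q * \<bar>d $ k\<bar> \<le> p * \<bar>u $ k\<bar>" if "k \<in> M" for k
  proof -
    have nz: "\<bar>real_of_int (d $ i)\<bar> > 0" "\<bar>real_of_int (d $ k)\<bar> > 0"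
      using i that by (auto simp: M_def)
    have "\<bar>real_of_int (u $ i)\<bar> * \<bar>real_of_int (d $ k)\<bar> \<le> \<bar>real_of_int (u $ k)\<bar> * \<bar>real_of_int (d $ i)\<bar>"
      using min[OF that] nz by (simp add: r_def field_simps)
    hence "real_of_int (q * \<bar>d $ k\<bar>) \<le> real_of_int (p * \<bar>u $ k\<bar>)"
      by (simp add: p_def q_def mult.commute)
    thus ?thesis by linarith
  qed
  let ?v = "p *s u - q *s d"
  have conf: "conformal ?v u"
    unfolding conformal_def
  proof (intro allI impI)
    fix k assume nz: "?v $ k \<noteq> 0"
    hence "u $ k \<noteq> 0"
      using assms(1) by (auto simp: subset_iff)
    hence abs: "\<bar>u $ k\<bar> > 0" by simp
    have *: "?v $ k * u $ k = p * (u $ k * u $ k) - q * (d $ k * u $ k)"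
      by (simp add: algebra_simps)
    have "0 \<le> ?v $ k * u $ k"
    proof (cases "k \<in> M")
      case True
      hence "q * (d $ k * u $ k) = q * \<bar>d $ k\<bar> * \<bar>u $ k\<bar>"
        by (simp add: M_def abs_mult[symmetric] mult.assoc)
      also have "\<dots> \<le> p * \<bar>u $ k\<bar> * \<bar>u $ k\<bar>"
        using key[OF True] by (simp add: mult_right_mono)
      finally show ?thesis unfolding * by (simp add: mult.assoc)
    next
      case False
      hence "q * (d $ k * u $ k) \<le> 0"
        using pq by (simp add: M_def mult_nonneg_nonpos)
      moreover have "0 \<le> p * (u $ k * u $ k)" using pq by simp
      ultimately show ?thesis unfolding * by linarith
    qed
    thus "0 < ?v $ k * u $ k" using nz \<open>u $ k \<noteq> 0\<close>
      by (metis less_le mult_eq_0_iff)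
  qed
  have "?v $ i = 0"
    using i by (auto simp: M_def p_def q_def zero_less_mult_iff)
  moreover have "u $ i \<noteq> 0" using i by (auto simp: M_def)
  ultimately have "supp ?v \<subset> supp u"
    using conformal_supp[OF conf] by (metis mem_supp psubsetI)
  with that pq conf show ?thesis by blast
qed

text \<open>The existence part of the decomposition of a lattice vector into conformal circuits. Given some
circuit \<open>e\<close> inside the support of \<open>u\<close>, either \<open>e\<close> itself works up to sign, or a
reduction of \<open>u\<close> along \<open>e\<close> shrinks the support. The sign of \<open>e\<close> is chosen so that
the reduction can only increase the absolute value of the coordinate \<open>j\<close>, which therefore stays
nonzero.\<close>

lemma conformal_circuit:
  fixes A :: "int ^ 'n::finite ^ 'd"
  assumes "u \<in> lattice_of A" "u $ j \<noteq> 0"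
  shows "\<exists>c. is_circuit A c \<and> conformal c u \<and> c $ j \<noteq> 0"
  using assms
proof (induction "card (supp u)" arbitrary: u rule: less_induct)
  case (less u)
  have "u \<noteq> 0" using less.prems by auto
  then obtain d where d: "is_circuit A d" "supp d \<subseteq> supp u"
    using exists_circuit less.prems by blast
  obtain k where k: "d $ k \<noteq> 0"
    using is_circuitD(2)[OF d(1)] by (auto simp: vec_eq_iff)
  have ku: "u $ k \<noteq> 0" using d(2) k by (auto simp: subset_iff)
  have "\<exists>e. is_circuit A e \<and> supp e \<subseteq> supp u \<and>
          (e $ j * u $ j \<le> 0 \<and> (\<exists>i. 0 < e $ i * u $ i) \<or> conformal e u \<and> e $ j \<noteq> 0)"
  proof (cases "d $ j = 0")
    case True
    show ?thesis
    proof (cases "0 < d $ k * u $ k")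
      case T: True
      thus ?thesis using True d by (intro exI[of _ d]) auto
    next
      case False
      hence "0 < (- d) $ k * u $ k"
        using k ku by (simp add: not_less) (metis less_le mult_eq_0_iff)
      moreover have "(- d) $ j * u $ j \<le> 0" using True by simp
      ultimately show ?thesis using d is_circuit_uminus[OF d(1)]
        by (metis supp_uminus)
    qed
  next
    case False
    obtain e where e: "is_circuit A e" "supp e \<subseteq> supp u" "e $ j \<noteq> 0" "e $ j * u $ j \<le> 0"
    proof (cases "d $ j * u $ j \<le> 0")
      case True
      thus ?thesis using that d False by blast
    next
      case F: False
      show ?thesis
        by (rule that[of "- d"]) (use F False d is_circuit_uminus[OF d(1)] in auto)
    qed
    show ?thesis
    proof (cases "\<exists>i. 0 < e $ i * u $ i")
      case True
      thus ?thesis using e by blast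
    next
      case F: False
      have "conformal (- e) u"
        unfolding conformal_def
      proof (intro allI impI)
        fix i assume "(- e) $ i \<noteq> 0"
        hence "e $ i \<noteq> 0" "u $ i \<noteq> 0" using e(2) by (auto simp: subset_iff)
        hence "e $ i * u $ i \<noteq> 0" by simp
        moreover have "\<not> 0 < e $ i * u $ i" using F by blast
        ultimately have "e $ i * u $ i < 0" by linarith
        thus "0 < (- e) $ i * u $ i" by simp
      qed
      thus ?thesis using e is_circuit_uminus[OF e(1)]
        by (intro exI[of _ "- e"]) auto
    qed
  qed
  then obtain e where e: "is_circuit A e" "supp e \<subseteq> supp u"
    and alt: "e $ j * u $ j \<le> 0 \<and> (\<exists>i. 0 < e $ i * u $ i) \<or> conformal e u \<and> e $ j \<noteq> 0"
    by blast
  from alt show ?case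
  proof
    assume "conformal e u \<and> e $ j \<noteq> 0"
    thus ?thesis using e by blast
  next
    assume h: "e $ j * u $ j \<le> 0 \<and> (\<exists>i. 0 < e $ i * u $ i)"
    then obtain p q where pq: "0 < p" "0 < q" "conformal (p *s u - q *s e) u"
        "supp (p *s u - q *s e) \<subset> supp u"
      using conformal_reduction[OF e(2)] by blast
    let ?v = "p *s u - q *s e"
    have "?v $ j * u $ j = p * (u $ j * u $ j) - q * (e $ j * u $ j)"
      by (simp add: algebra_simps)
    moreover have "0 < p * (u $ j * u $ j)"
      using pq less.prems(2) by (simp add: zero_less_mult_iff) linarith
    moreover have "q * (e $ j * u $ j) \<le> 0"
      using h pq by (simp add: mult_nonneg_nonpos)
    ultimately have "0 < ?v $ j * u $ j" by linarith
    hence "?v $ j \<noteq> 0" by (metis less_irrefl mult_zero_left)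
    moreover have "?v \<in> lattice_of A"
      using less.prems is_circuitD(1)[OF e(1)] by (intro lattice_diff lattice_smult)
    moreover have "card (supp ?v) < card (supp u)"
      by (rule psubset_card_mono[OF finite pq(4)])
    ultimately obtain c where "is_circuit A c" "conformal c ?v" "c $ j \<noteq> 0"
      using less.hyps by blast
    thus ?thesis using conformal_trans pq(3) by blast
  qed
qed

text \<open>Eliminating a common coordinate of two circuits with the same support gives a lattice vector of
smaller support, hence zero; so the circuits are proportional, and being primitive they agree up
to sign.\<close>

lemma circuit_eqI:
  fixes A :: "int ^ 'n::finite ^ 'd"
  assumes c: "is_circuit A c" and d: "is_circuit A d"
    and pos: "{i. 0 < c $ i} = {i. 0 < d $ i}" and neg: "{i. c $ i < 0} = {i. d $ i < 0}"
  shows "c = d"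
proof -
  have pos': "0 < c $ i \<longleftrightarrow> 0 < d $ i" and neg': "c $ i < 0 \<longleftrightarrow> d $ i < 0" for i
    using pos neg by blast+
  have supp: "supp c = supp d"
  proof -
    have "c $ i \<noteq> 0 \<longleftrightarrow> d $ i \<noteq> 0" for i
      using pos'[of i] neg'[of i] by linarith
    thus ?thesis by (simp add: supp_def)
  qed
  obtain i where i: "c $ i \<noteq> 0"
    using is_circuitD(2)[OF c] by (auto simp: vec_eq_iff)
  let ?e = "d $ i *s c - c $ i *s d"
  have "?e \<in> lattice_of A"
    using is_circuitD(1)[OF c] is_circuitD(1)[OF d] by (intro lattice_diff lattice_smult)
  moreover have "supp ?e \<subset> supp c"
  proof (rule psubsetI)
    have "?e $ j = 0" if "c $ j = 0" for j
    proof -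
      have "d $ j = 0" using that supp by (metis mem_supp)
      thus ?thesis using that by simp
    qed
    thus "supp ?e \<subseteq> supp c" by (metis mem_supp subsetI)
    have "?e $ i = 0" by simp
    thus "supp ?e \<noteq> supp c" using i by (metis mem_supp)
  qed
  ultimately have "?e = 0" using is_circuitD(4)[OF c] by blast
  hence eq: "d $ i *s c = c $ i *s d" by simp
  have "\<bar>d $ i\<bar> = \<bar>c $ i\<bar>"
    using Gcd_smult[of "d $ i" c] Gcd_smult[of "c $ i" d] eq is_circuitD(3)[OF c] is_circuitD(3)[OF d]
    by (simp only: mult_1_right)
  hence "d $ i = c $ i" using pos'[of i] neg'[of i] by linarith
  hence "c $ i * c $ j = c $ i * d $ j" for j
    using arg_cong[OF eq, of "\<lambda>x. x $ j"] by simp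
  with i show ?thesis by (simp add: vec_eq_iff)
qed

lemma finite_circuits: "finite {c. is_circuit (A :: int ^ 'n::finite ^ 'd) c}"
proof (rule inj_on_finite)
  show "inj_on (\<lambda>c. ({i. 0 < c $ i}, {i. c $ i < 0})) {c. is_circuit A c}"
    by (rule inj_onI) (auto intro: circuit_eqI)
  show "(\<lambda>c. ({i. 0 < c $ i}, {i. c $ i < 0})) ` {c. is_circuit A c} \<subseteq> (UNIV :: ('n set \<times> 'n set) set)"
    by simp
  show "finite (UNIV :: ('n set \<times> 'n set) set)" by simp
qed

text \<open>A circuit \<open>c\<close> is primitive, so some entry \<open>c $ i\<close> is prime to \<open>p\<close>. Eliminating coordinate \<open>i\<close> from
\<open>u\<close> multiplies \<open>u\<close> by this entry only, and the result has smaller support.\<close>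

lemma multiple_in_circuit_span:
  fixes A :: "int ^ 'n::finite ^ 'd"
  assumes G0: "0 \<in> G" and Gdiff: "\<And>u v. u \<in> G \<Longrightarrow> v \<in> G \<Longrightarrow> u - v \<in> G"
    and Gcirc: "\<And>c. is_circuit A c \<Longrightarrow> supp c \<subseteq> S \<Longrightarrow> c \<in> G"
    and p: "prime (p :: int)"
    and u: "u \<in> lattice_of A" "supp u \<subseteq> S"
  shows "\<exists>N. \<not> p dvd N \<and> N *s u \<in> G"
  using u
proof (induction "card (supp u)" arbitrary: u rule: less_induct)
  case (less u)
  have Gadd: "u + v \<in> G" if "u \<in> G" "v \<in> G" for u v
    using Gdiff[OF that(1) Gdiff[OF G0 that(2)]] by simp
  have Gnat: "int n *s u \<in> G" if "u \<in> G" for n u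
    using that by (induction n) (auto simp: G0 Gadd vector_sadd_rdistrib)
  have Gsmult: "k *s u \<in> G" if "u \<in> G" for k u
  proof (cases "0 \<le> k")
    case True
    thus ?thesis using Gnat[OF that, of "nat k"] by simp
  next
    case False
    have "k *s u = 0 - int (nat (- k)) *s u"
      using False by (simp add: vec_eq_iff)
    thus ?thesis using Gdiff[OF G0 Gnat[OF that, of "nat (- k)"]] by simp
  qed
  show ?case
  proof (cases "u = 0")
    case True
    thus ?thesis using G0 p by (intro exI[of _ 1]) (auto dest: not_prime_unit)
  next
    case False
    then obtain c where c: "is_circuit A c" "supp c \<subseteq> supp u"
      using exists_circuit less.prems by blast
    have "\<exists>i. \<not> p dvd c $ i"
    proof (rule ccontr)
      assume "\<nexists>i. \<not> p dvd c $ i"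
      hence "p dvd (GCD i\<in>UNIV. c $ i)" by (auto intro: Gcd_greatest)
      thus False using is_circuitD(3)[OF c(1)] p by auto
    qed
    then obtain i where i: "\<not> p dvd c $ i" by blast
    hence "c $ i \<noteq> 0" by auto
    let ?v = "c $ i *s u - u $ i *s c"
    have sub: "supp ?v \<subset> supp u"
    proof (rule psubsetI)
      have "?v $ j = 0" if "u $ j = 0" for j
        using that c(2) by (auto simp: subset_iff)
      thus "supp ?v \<subseteq> supp u" by (metis mem_supp subsetI)
      have "?v $ i = 0" "u $ i \<noteq> 0" using \<open>c $ i \<noteq> 0\<close> c(2) by (auto simp: subset_iff)
      thus "supp ?v \<noteq> supp u" by (metis mem_supp)
    qed
    have "?v \<in> lattice_of A"
      using less.prems is_circuitD(1)[OF c(1)] by (intro lattice_diff lattice_smult)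
    moreover have "supp ?v \<subseteq> S"
      using sub less.prems(2) by blast
    moreover have "card (supp ?v) < card (supp u)"
      by (rule psubset_card_mono[OF finite sub])
    ultimately obtain N where N: "\<not> p dvd N" "N *s ?v \<in> G"
      using less.hyps[of ?v] by blast
    have "c \<in> G" using Gcirc c less.prems by blast
    hence "N *s ?v + (N * u $ i) *s c \<in> G"
      by (intro Gadd N Gsmult)
    moreover have "N *s ?v + (N * u $ i) *s c = (N * c $ i) *s u"
      by (simp add: vec_eq_iff algebra_simps)
    moreover have "\<not> p dvd N * c $ i"
      using N i p by (simp add: prime_dvd_mult_iff)
    ultimately show ?thesis by metis
  qed
qed

text \<open>The multipliers carrying \<open>u\<close> into a subgroup \<open>G\<close> form an ideal of the integers. By the preceding
lemma no prime divides all of them, so the ideal contains \<open>1\<close>.\<close>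

lemma circuits_generate_lattice:
  fixes A :: "int ^ 'n::finite ^ 'd"
  assumes G0: "0 \<in> G" and Gdiff: "\<And>u v. u \<in> G \<Longrightarrow> v \<in> G \<Longrightarrow> u - v \<in> G"
    and Gcirc: "\<And>c. is_circuit A c \<Longrightarrow> supp c \<subseteq> S \<Longrightarrow> c \<in> G"
    and u: "u \<in> lattice_of A" "supp u \<subseteq> S"
  shows "u \<in> G"
proof -
  define H where "H = {N :: int. N *s u \<in> G}"
  have Hdiff: "M - N \<in> H" if "M \<in> H" "N \<in> H" for M N
  proof -
    have "(M - N) *s u = M *s u - N *s u" by (simp add: vec_eq_iff left_diff_distrib)
    thus ?thesis using Gdiff that by (simp add: H_def)
  qed
  have H0: "0 \<in> H" using G0 by (simp add: H_def)
  have Hminus: "- N \<in> H" if "N \<in> H" for N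
    using Hdiff[OF H0 that] by simp
  have Hadd: "M + N \<in> H" if "M \<in> H" "N \<in> H" for M N
    using Hdiff[OF that(1) Hminus[OF that(2)]] by simp
  have Hnat: "int n * N \<in> H" if "N \<in> H" for n N
    using that by (induction n) (simp_all add: H0 Hadd distrib_right)
  have Hmult: "k * N \<in> H" if "N \<in> H" for k N
    using Hnat[OF that, of "nat k"] Hminus[OF Hnat[OF that, of "nat (- k)"]] by (cases "0 \<le> k") auto
  have avoid: "\<exists>N\<in>H. \<not> p dvd N" if "prime p" for p
    using multiple_in_circuit_span[OF G0 Gdiff Gcirc that u] by (auto simp: H_def)
  define P where "P n \<longleftrightarrow> 0 < n \<and> int n \<in> H" for n
  obtain N where N: "N \<in> H" "\<not> 2 dvd N"
    using avoid[of 2] by auto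
  moreover have "N \<noteq> 0" using N(2) by auto
  ultimately have "P (nat \<bar>N\<bar>)"
    using Hminus[OF N(1)] by (cases "0 \<le> N") (auto simp: P_def)
  then obtain g where g: "P g" and min: "\<And>n. P n \<Longrightarrow> g \<le> n"
    using ex_has_least_nat[of P _ "\<lambda>n. n"] by blast
  have dvd: "int g dvd M" if "M \<in> H" for M
  proof (rule ccontr)
    assume "\<not> int g dvd M"
    hence "M mod int g \<noteq> 0" by (simp add: dvd_eq_mod_eq_0)
    moreover have "0 \<le> M mod int g" "M mod int g < int g" using g by (auto simp: P_def)
    moreover have "M mod int g \<in> H"
      using Hdiff[OF that Hmult[of "int g" "M div int g"]] g
      by (simp add: P_def minus_div_mult_eq_mod)
    ultimately have "P (nat (M mod int g))" "nat (M mod int g) < g"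
      by (auto simp: P_def)
    thus False using min by fastforce
  qed
  have "g = 1"
  proof (rule ccontr)
    assume "g \<noteq> 1"
    then obtain p where "prime p" "p dvd g" using prime_factor_nat by blast
    hence "prime (int p)" "int p dvd int g" by auto
    thus False using avoid dvd dvd_trans by blast
  qed
  thus ?thesis using g by (simp add: P_def H_def)
qed

section \<open>Regular subdivisions\<close>

definition cost :: "real ^ 'n::finite \<Rightarrow> int ^ 'n \<Rightarrow> real" where
  "cost \<omega> u = \<omega> \<bullet> (\<chi> i. real_of_int (u $ i))"

lemma cost_add_right: "cost \<omega> (u + v) = cost \<omega> u + cost \<omega> v"
  by (simp add: cost_def inner_vec_def sum.distrib algebra_simps)

lemma cost_diff_right: "cost \<omega> (u - v) = cost \<omega> u - cost \<omega> v"
  by (simp add: cost_def inner_vec_def sum_subtractf algebra_simps)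

lemma cost_uminus_right: "cost \<omega> (- u) = - cost \<omega> u"
  by (simp add: cost_def inner_vec_def sum_negf)

lemma cost_smult_right: "cost \<omega> (k *s u) = real_of_int k * cost \<omega> u"
  by (simp add: cost_def inner_vec_def sum_distrib_left algebra_simps)

lemma cost_0_right [simp]: "cost \<omega> 0 = 0"
  by (simp add: cost_def inner_vec_def)

lemma cost_add_left: "cost (x + y) u = cost x u + cost y u"
  by (simp add: cost_def inner_add_left)

lemma cost_scale_left: "cost (t *\<^sub>R x) u = t * cost x u"
  by (simp add: cost_def)

lemma cost_diff_left: "cost (x - y) u = cost x u - cost y u"
  by (simp add: cost_def inner_diff_left)

text \<open>By linear programming duality, \<open>\<sigma>\<close> satisfies this condition iff some \<open>y\<close> has
\<open>y \<bullet> a\<^sub>i \<le> \<omega>\<^sub>i\<close> for all \<open>i\<close>, with equality for \<open>i \<in> \<sigma>\<close>; that is, iff \<open>\<sigma>\<close> lies in a cell of the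
regular subdivision induced by \<open>\<omega>\<close>. Formulating it on the lattice itself avoids duality
altogether: it says that moving away from a vector supported in \<open>\<sigma>\<close>, within the nonnegative
orthant, never lowers the cost.\<close>

definition subcells :: "int ^ 'n::finite ^ 'd \<Rightarrow> real ^ 'n \<Rightarrow> 'n set set" where
  "subcells A \<omega> =
     {\<sigma>. \<forall>u\<in>lattice_of A. (\<forall>i. i \<notin> \<sigma> \<longrightarrow> 0 \<le> u $ i) \<longrightarrow> 0 \<le> cost \<omega> u}"

lemma subcellsD:
  "\<sigma> \<in> subcells A \<omega> \<Longrightarrow> u \<in> lattice_of A \<Longrightarrow> (\<And>i. i \<notin> \<sigma> \<Longrightarrow> 0 \<le> u $ i) \<Longrightarrow> 0 \<le> cost \<omega> u"
  by (auto simp: subcells_def)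

lemma subcells_mono: "\<sigma> \<in> subcells A \<omega> \<Longrightarrow> \<tau> \<subseteq> \<sigma> \<Longrightarrow> \<tau> \<in> subcells A \<omega>"
  by (auto simp: subcells_def)

text \<open>A positive multiple of \<open>u\<close> is a nonnegative combination of circuits conformal to \<open>u\<close>, and these
are nonnegative wherever \<open>u\<close> is. Hence finitely many inequalities suffice in the definition of
\<open>subcells\<close>, which is what makes the cones below polyhedral.\<close>

lemma cost_nonneg_of_circuits:
  fixes A :: "int ^ 'n::finite ^ 'd"
  assumes circ: "\<And>c. is_circuit A c \<Longrightarrow> (\<And>i. i \<notin> \<sigma> \<Longrightarrow> 0 \<le> c $ i) \<Longrightarrow> 0 \<le> cost \<omega> c"
    and u: "u \<in> lattice_of A" "\<And>i. i \<notin> \<sigma> \<Longrightarrow> 0 \<le> u $ i"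
  shows "0 \<le> cost \<omega> u"
  using u
proof (induction "card (supp u)" arbitrary: u rule: less_induct)
  case (less u)
  show ?case
  proof (cases "u = 0")
    case False
    then obtain j where "u $ j \<noteq> 0" by (auto simp: vec_eq_iff)
    then obtain c where c: "is_circuit A c" "conformal c u" "c $ j \<noteq> 0"
      using conformal_circuit less.prems(1) by blast
    hence "\<exists>i. 0 < c $ i * u $ i" by (auto simp: conformal_def)
    then obtain p q where pq: "0 < p" "0 < q" "conformal (p *s u - q *s c) u"
        "supp (p *s u - q *s c) \<subset> supp u"
      using conformal_reduction[OF conformal_supp[OF c(2)]] by blast
    let ?v = "p *s u - q *s c"
    have "card (supp ?v) < card (supp u)"
      by (rule psubset_card_mono[OF finite pq(4)])
    moreover have "?v \<in> lattice_of A"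
      using less.prems(1) is_circuitD(1)[OF c(1)] by (intro lattice_diff lattice_smult)
    moreover have "0 \<le> ?v $ i" if "i \<notin> \<sigma>" for i
      using conformal_nonneg[OF pq(3) less.prems(2)[OF that]] .
    ultimately have "0 \<le> cost \<omega> ?v" by (rule less.hyps)
    moreover have "0 \<le> cost \<omega> c"
      using conformal_nonneg[OF c(2) less.prems(2)] by (intro circ c(1))
    moreover have "cost \<omega> ?v = real_of_int p * cost \<omega> u - real_of_int q * cost \<omega> c"
      by (simp add: cost_diff_right cost_smult_right)
    ultimately have "0 \<le> real_of_int p * cost \<omega> u"
      using pq(2) by (smt (verit) mult_nonneg_nonneg of_int_0_le_iff)
    thus ?thesis using pq(1) by (simp add: zero_le_mult_iff)
  qed simp
qed

lemma subcells_cost_le: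
  assumes "\<sigma> \<in> subcells A \<omega>" "supp w \<subseteq> \<sigma>" "\<And>i. 0 \<le> w' $ i" "w' - w \<in> lattice_of A"
  shows "cost \<omega> w \<le> cost \<omega> w'"
proof -
  have "0 \<le> (w' - w) $ i" if "i \<notin> \<sigma>" for i
  proof -
    have "w $ i = 0" using that assms(2) by auto
    thus ?thesis using assms(3)[of i] by simp
  qed
  from subcellsD[OF assms(1,4) this] show ?thesis by (simp add: cost_diff_right)
qed

text \<open>Moving from \<open>w\<close> by a small multiple of \<open>z\<close> stays nonnegative, because \<open>z\<close> can be negative
only where \<open>w\<close> is positive; scaling by \<open>N\<close> keeps the vectors integral.\<close>

lemma nonneg_multiple:
  fixes w z :: "int ^ 'n::finite"
  assumes "\<And>i. 0 \<le> w $ i" and "\<And>i. i \<notin> supp w \<Longrightarrow> 0 \<le> z $ i"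
  obtains N where "0 < N" "\<And>i. 0 \<le> (N *s w + z) $ i"
proof
  define N where "N = 1 + (\<Sum>i\<in>UNIV. \<bar>z $ i\<bar>)"
  have bound: "\<bar>z $ i\<bar> \<le> N" for i
    using member_le_sum[of i UNIV "\<lambda>i. \<bar>z $ i\<bar>"] by (simp add: N_def)
  show "0 < N" by (simp add: N_def add_pos_nonneg sum_nonneg)
  show "0 \<le> (N *s w + z) $ i" for i
  proof (cases "w $ i = 0")
    case True
    thus ?thesis using assms(2)[of i] by simp
  next
    case False
    hence "1 \<le> w $ i" using assms(1)[of i] by linarith
    hence "N * 1 \<le> N * w $ i" using \<open>0 < N\<close> by (intro mult_left_mono) auto
    thus ?thesis using bound[of i] by simp
  qed
qed

text \<open>The support of any optimal point of a fibre lies in a cell: a move \<open>z\<close> from \<open>w'\<close> is, after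
rescaling, a move from \<open>w\<close> that passes through \<open>w'\<close> at no extra cost.\<close>

lemma subcells_of_cost_le:
  assumes "supp w \<in> subcells A \<omega>" "\<And>i. 0 \<le> w' $ i" "w' - w \<in> lattice_of A"
    and le: "cost \<omega> w' \<le> cost \<omega> w"
  shows "supp w' \<in> subcells A \<omega>"
  unfolding subcells_def
proof (intro CollectI ballI impI)
  fix z assume z: "z \<in> lattice_of A" "\<forall>i. i \<notin> supp w' \<longrightarrow> 0 \<le> z $ i"
  then obtain N where N: "0 < N" "\<And>i. 0 \<le> (N *s w' + z) $ i"
    using nonneg_multiple[OF assms(2), of z] by blast
  have "0 \<le> cost \<omega> (N *s (w' - w) + z)"
  proof (rule subcellsD[OF assms(1)])
    show "N *s (w' - w) + z \<in> lattice_of A"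
      by (intro lattice_add lattice_smult assms z)
    show "0 \<le> (N *s (w' - w) + z) $ i" if "i \<notin> supp w" for i
      using N(2)[of i] that by simp
  qed
  moreover have "real_of_int N * (cost \<omega> w' - cost \<omega> w) \<le> 0"
    using N(1) le by (simp add: mult_nonneg_nonpos)
  ultimately show "0 \<le> cost \<omega> z"
    by (simp add: cost_add_right cost_smult_right cost_diff_right right_diff_distrib)
qed

text \<open>Equivalently, all fibres are bounded, so linear costs attain their minimum on them.\<close>

abbreviation pointed :: "int ^ 'n ^ 'd \<Rightarrow> bool" where
  "pointed A \<equiv> lattice_of A \<inter> {u. \<forall>i. 0 \<le> u $ i} = {0}"

text \<open>The columns of \<open>A\<close> indexed by \<open>T\<close> are linearly independent; nonnegative vectors with such a
support are the vertices of their fibre.\<close>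

definition lattice_independent :: "int ^ 'n ^ 'd \<Rightarrow> 'n set \<Rightarrow> bool" where
  "lattice_independent A T \<longleftrightarrow> (\<forall>u\<in>lattice_of A. supp u \<subseteq> T \<longrightarrow> u = 0)"

text \<open>If \<open>x\<close> is not a vertex of its fibre, one can move along a lattice direction inside \<open>supp x\<close> without
raising the cost. Pointedness guarantees that some coordinate decreases, so the movement ends by
losing a coordinate of the support. The factor \<open>m\<close> clears denominators.\<close>

lemma descend_to_vertex:
  fixes A :: "int ^ 'n::finite ^ 'd"
  assumes "pointed A" and "\<And>i. 0 \<le> x $ i"
  shows "\<exists>m y. 0 < m \<and> (\<forall>i. 0 \<le> y $ i) \<and> y - m *s x \<in> lattice_of A \<and>
           lattice_independent A (supp y) \<and> cost \<omega> y \<le> real_of_int m * cost \<omega> x"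
  using assms(2)
proof (induction "card (supp x)" arbitrary: x rule: less_induct)
  case (less x)
  show ?case
  proof (cases "lattice_independent A (supp x)")
    case True
    have "x - 1 *s x = 0" by simp
    thus ?thesis using True less.prems
      by (intro exI[of _ 1] exI[of _ x]) auto
  next
    case False
    then obtain u0 where u0: "u0 \<in> lattice_of A" "supp u0 \<subseteq> supp x" "u0 \<noteq> 0"
      by (auto simp: lattice_independent_def)
    define u where "u = (if cost \<omega> u0 \<le> 0 then u0 else - u0)"
    have u: "u \<in> lattice_of A" "supp u \<subseteq> supp x" "u \<noteq> 0" "cost \<omega> u \<le> 0"
      using u0 by (auto simp: u_def lattice_uminus cost_uminus_right)
    have "\<exists>i. u $ i < 0"
    proof (rule ccontr)
      assume "\<nexists>i. u $ i < 0"
      hence "u \<in> lattice_of A \<inter> {u. \<forall>i. 0 \<le> u $ i}"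
        using u(1) by (auto simp: not_less)
      thus False using assms(1) u(3) by simp
    qed
    then obtain k where k: "u $ k < 0" by blast
    moreover have "0 < x $ k"
      using less.prems[of k] u(2) k by (metis less_irrefl less_le mem_supp subsetD)
    ultimately have "\<exists>i. 0 < (- u) $ i * x $ i"
      by (intro exI[of _ k]) (simp add: mult_neg_pos)
    moreover have "supp (- u) \<subseteq> supp x" using u(2) by simp
    ultimately obtain p q where pq: "0 < p" "0 < q" "conformal (p *s x - q *s (- u)) x"
        "supp (p *s x - q *s (- u)) \<subset> supp x"
      using conformal_reduction by blast
    define v where "v = p *s x + q *s u"
    have v_eq: "p *s x - q *s (- u) = v" by (simp add: v_def vec_eq_iff)
    have "card (supp v) < card (supp x)"
      using psubset_card_mono[OF finite pq(4)] unfolding v_eq .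
    moreover have "0 \<le> v $ i" for i
      using conformal_nonneg[OF pq(3) less.prems] unfolding v_eq .
    ultimately obtain m y where m: "0 < m" and y: "\<forall>i. 0 \<le> y $ i" "y - m *s v \<in> lattice_of A"
        "lattice_independent A (supp y)" "cost \<omega> y \<le> real_of_int m * cost \<omega> v"
      using less.hyps by blast
    have "y - (m * p) *s x = (y - m *s v) + (m * q) *s u"
      by (simp add: v_def vec_eq_iff algebra_simps)
    also have "\<dots> \<in> lattice_of A"
      by (intro lattice_add lattice_smult y u)
    finally have "y - (m * p) *s x \<in> lattice_of A" .
    moreover have "cost \<omega> y \<le> real_of_int (m * p) * cost \<omega> x"
    proof -
      have "cost \<omega> v = real_of_int p * cost \<omega> x + real_of_int q * cost \<omega> u"
        by (simp add: v_def cost_add_right cost_smult_right)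
      also have "\<dots> \<le> real_of_int p * cost \<omega> x"
        using pq(2) u(4) by (simp add: mult_nonneg_nonpos)
      finally have "real_of_int m * cost \<omega> v \<le> real_of_int m * (real_of_int p * cost \<omega> x)"
        using m by (intro mult_left_mono) auto
      thus ?thesis using y(4) by simp
    qed
    moreover have "0 < m * p" using m pq(1) by simp
    ultimately show ?thesis using y by blast
  qed
qed

lemma finite_image_factor:
  assumes "finite (f ` Q)" and "\<And>x y. x \<in> Q \<Longrightarrow> y \<in> Q \<Longrightarrow> f x = f y \<Longrightarrow> g x = g y"
  shows "finite (g ` Q)"
proof -
  have "g x = g (SOME y. y \<in> Q \<and> f y = f x)" if "x \<in> Q" for x
  proof -
    have "\<exists>y. y \<in> Q \<and> f y = f x" using that by blast
    from someI_ex[OF this] show ?thesis using assms(2)[OF that] by metis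
  qed
  hence "g ` Q \<subseteq> (\<lambda>t. g (SOME y. y \<in> Q \<and> f y = t)) ` (f ` Q)"
    by (auto simp: image_image)
  thus ?thesis using assms(1) by (meson finite_imageI finite_subset)
qed

text \<open>A rational linear program with a real cost function has an optimal vertex. Points of a fibre with
different multipliers \<open>m\<close> are compared by their cost per unit of \<open>x\<close>. This ratio depends only on
the support of a vertex, so it takes finitely many values; a vertex minimizing it is optimal by
the descent lemma, and then its support lies in a cell.\<close>

lemma exists_optimum:
  fixes A :: "int ^ 'n::finite ^ 'd"
  assumes "pointed A" and x: "\<And>i. 0 \<le> x $ i"
  obtains m y where "0 < m" "\<And>i. 0 \<le> y $ i" "y - m *s x \<in> lattice_of A"
    "supp y \<in> subcells A \<omega>"
proof -
  define Q where "Q = {(m, y). 0 < m \<and> (\<forall>i. 0 \<le> y $ i) \<and> y - m *s x \<in> lattice_of A \<and>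
                          lattice_independent A (supp y)}"
  define ratio where "ratio = (\<lambda>(m, y). cost \<omega> y / real_of_int m)"
  have "finite (ratio ` Q)"
  proof (rule finite_image_factor)
    show "finite ((\<lambda>(m, y). supp y) ` Q)" by simp
    fix z z' assume z: "z \<in> Q" "z' \<in> Q" and eq: "(\<lambda>(m, y). supp y) z = (\<lambda>(m, y). supp y) z'"
    obtain m y m' y' where zz: "z = (m, y)" "z' = (m', y')" by (metis surj_pair)
    have my: "0 < m" "0 < m'" "y - m *s x \<in> lattice_of A" "y' - m' *s x \<in> lattice_of A"
      "lattice_independent A (supp y)" and supp: "supp y = supp y'"
      using z eq by (auto simp: zz Q_def)
    have "m' *s y - m *s y' = m' *s (y - m *s x) - m *s (y' - m' *s x)"
      by (simp add: vec_eq_iff algebra_simps)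
    also have "\<dots> \<in> lattice_of A"
      by (intro lattice_diff lattice_smult my)
    finally have "m' *s y - m *s y' \<in> lattice_of A" .
    moreover have "supp (m' *s y - m *s y') \<subseteq> supp y"
    proof -
      have "y' $ i = 0" if "y $ i = 0" for i using supp that by (metis mem_supp)
      thus ?thesis by auto
    qed
    ultimately have "m' *s y - m *s y' = 0"
      using my(5) by (auto simp: lattice_independent_def)
    hence "cost \<omega> (m' *s y) = cost \<omega> (m *s y')" by simp
    thus "ratio z = ratio z'"
      using my by (simp add: ratio_def zz cost_smult_right field_simps)
  qed
  moreover have "Q \<noteq> {}"
    using descend_to_vertex[OF assms, of \<omega>] unfolding Q_def by fast
  ultimately have "Min (ratio ` Q) \<in> ratio ` Q" by (intro Min_in) auto
  then obtain z where z: "z \<in> Q" "Min (ratio ` Q) = ratio z" by blast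
  have min: "ratio z \<le> ratio z'" if "z' \<in> Q" for z'
    using Min_le[OF \<open>finite (ratio ` Q)\<close> imageI[OF that]] z(2) by simp
  obtain m y where zz: "z = (m, y)" by (cases z)
  have m: "0 < m" and y: "\<And>i. 0 \<le> y $ i" "y - m *s x \<in> lattice_of A"
    using z by (auto simp: zz Q_def)
  have "supp y \<in> subcells A \<omega>"
    unfolding subcells_def
  proof (intro CollectI ballI impI)
    fix u assume u: "u \<in> lattice_of A" "\<forall>i. i \<notin> supp y \<longrightarrow> 0 \<le> u $ i"
    then obtain N where N: "0 < N" "\<And>i. 0 \<le> (N *s y + u) $ i"
      using nonneg_multiple[OF y(1), of u] by blast
    obtain m' y' where m': "0 < m'" and y': "\<forall>i. 0 \<le> y' $ i"
        "y' - m' *s (N *s y + u) \<in> lattice_of A" "lattice_independent A (supp y')"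
        "cost \<omega> y' \<le> real_of_int m' * cost \<omega> (N *s y + u)"
      using descend_to_vertex[OF assms(1) N(2)] by blast
    have "y' - (m' * N * m) *s x =
            (y' - m' *s (N *s y + u)) + m' *s u + (m' * N) *s (y - m *s x)"
      by (simp add: vec_eq_iff algebra_simps)
    also have "\<dots> \<in> lattice_of A"
      by (intro lattice_add lattice_smult y' u y)
    finally have "(m' * N * m, y') \<in> Q"
      using m m' N y' by (simp add: Q_def)
    from min[OF this] have "cost \<omega> y / m \<le> cost \<omega> y' / (m' * N * m)"
      by (simp add: zz ratio_def)
    hence "real_of_int (m' * N) * cost \<omega> y \<le> cost \<omega> y'"
      using m m' N by (simp add: field_simps)
    also have "\<dots> \<le> real_of_int (m' * N) * cost \<omega> y + real_of_int m' * cost \<omega> u"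
      using y'(4) by (simp add: cost_add_right cost_smult_right algebra_simps)
    finally show "0 \<le> cost \<omega> u" using m' by (simp add: zero_le_mult_iff)
  qed
  with that m y show ?thesis by blast
qed

text \<open>Let \<open>\<sigma>\<close> be in a cell for \<open>x + y\<close>, let \<open>w\<close> be the indicator vector of \<open>\<sigma>\<close>, and let \<open>w'\<close> be
\<open>\<theta>\<close>-optimal in the fibre of a multiple of \<open>w\<close>. As cells for \<open>\<theta>\<close> are contained in cells for
\<open>x\<close> and for \<open>y\<close>, \<open>w'\<close> is optimal for both, while the multiple of \<open>w\<close> is optimal for the sum.
So the latter is optimal for each summand too, and its support \<open>\<sigma>\<close> lies in a cell for each.\<close>

lemma subcells_add:
  fixes A :: "int ^ 'n::finite ^ 'd"
  assumes "pointed A" and x: "subcells A \<theta> \<subseteq> subcells A x" and y: "subcells A \<theta> \<subseteq> subcells A y"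
  shows "subcells A (x + y) = subcells A x \<inter> subcells A y"
proof
  show "subcells A x \<inter> subcells A y \<subseteq> subcells A (x + y)"
    by (auto simp: subcells_def cost_add_left)
  show "subcells A (x + y) \<subseteq> subcells A x \<inter> subcells A y"
  proof
    fix \<sigma> assume \<sigma>: "\<sigma> \<in> subcells A (x + y)"
    define w :: "int ^ 'n" where "w = (\<chi> i. if i \<in> \<sigma> then 1 else 0)"
    have w: "0 \<le> w $ i" for i by (simp add: w_def)
    obtain m w' where m: "0 < m" and w': "\<And>i. 0 \<le> w' $ i" "w' - m *s w \<in> lattice_of A"
        "supp w' \<in> subcells A \<theta>"
      using exists_optimum[OF assms(1) w] by metis
    have supp: "supp (m *s w) = \<sigma>" using m by (auto simp: w_def split: if_splits)
    have w0: "0 \<le> (m *s w) $ i" for i using w[of i] m by simp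
    have lat: "m *s w - w' \<in> lattice_of A"
      using lattice_uminus[OF w'(2)] by simp
    have "supp w' \<in> subcells A x" "supp w' \<in> subcells A y" using x y w'(3) by auto
    hence "cost x w' \<le> cost x (m *s w)" "cost y w' \<le> cost y (m *s w)"
      using subcells_cost_le[OF _ order_refl w0 lat] by auto
    moreover have "cost (x + y) (m *s w) \<le> cost (x + y) w'"
      using subcells_cost_le[OF \<sigma> _ w'(1,2)] supp by simp
    ultimately have "cost x (m *s w) \<le> cost x w'" "cost y (m *s w) \<le> cost y w'"
      by (auto simp: cost_add_left)
    hence "supp (m *s w) \<in> subcells A x" "supp (m *s w) \<in> subcells A y"
      using subcells_of_cost_le[OF _ w0 lat] \<open>supp w' \<in> subcells A x\<close> \<open>supp w' \<in> subcells A y\<close>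
      by auto
    thus "\<sigma> \<in> subcells A x \<inter> subcells A y" by (simp add: supp)
  qed
qed

lemma subcells_scale: "0 < t \<Longrightarrow> subcells A (t *\<^sub>R x) = subcells A x"
  by (simp add: subcells_def cost_scale_left zero_le_mult_iff)

section \<open>The fan of secondary cones\<close>

definition secondary_cone :: "int ^ 'n::finite ^ 'd \<Rightarrow> real ^ 'n \<Rightarrow> (real ^ 'n) set" where
  "secondary_cone A \<theta> = {x. subcells A \<theta> \<subseteq> subcells A x}"

lemma secondary_cone_refl [simp]: "\<theta> \<in> secondary_cone A \<theta>"
  by (simp add: secondary_cone_def)

lemma secondary_cone_subset: "x \<in> secondary_cone A \<theta> \<Longrightarrow> secondary_cone A x \<subseteq> secondary_cone A \<theta>"
  by (auto simp: secondary_cone_def)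

lemma secondary_cone_halfspaces:
  "secondary_cone A \<theta> =
     \<Inter> ((\<lambda>c. {x. 0 \<le> cost x c}) ` {c. is_circuit A c \<and> (\<exists>\<sigma>\<in>subcells A \<theta>. \<forall>i. i \<notin> \<sigma> \<longrightarrow> 0 \<le> c $ i)})"
  (is "_ = ?R")
proof
  show "secondary_cone A \<theta> \<subseteq> ?R"
    by (auto simp: secondary_cone_def intro: subcellsD is_circuitD(1))
  show "?R \<subseteq> secondary_cone A \<theta>"
  proof
    fix x assume "x \<in> ?R"
    hence x: "0 \<le> cost x c" if "is_circuit A c" "\<sigma> \<in> subcells A \<theta>" "\<And>i. i \<notin> \<sigma> \<Longrightarrow> 0 \<le> c $ i" for c \<sigma>
      using that by blast
    have "\<sigma> \<in> subcells A x" if "\<sigma> \<in> subcells A \<theta>" for \<sigma>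
      unfolding subcells_def using x that cost_nonneg_of_circuits[of A \<sigma> x] by blast
    thus "x \<in> secondary_cone A \<theta>" by (auto simp: secondary_cone_def)
  qed
qed

lemma halfspace_cost: "{x. 0 \<le> cost x c} = {x. (\<chi> i. real_of_int (c $ i)) \<bullet> x \<ge> 0}"
  by (simp add: cost_def inner_commute)

lemma polyhedron_secondary_cone: "polyhedron (secondary_cone A \<theta>)"
  unfolding secondary_cone_halfspaces halfspace_cost
  by (rule polyhedron_Inter) (auto simp: finite_circuits polyhedron_halfspace_ge)

lemma convex_cone_secondary_cone: "convex_cone (secondary_cone A \<theta>)"
  unfolding secondary_cone_halfspaces halfspace_cost
  by (rule convex_cone_Inter) (auto simp: convex_cone_halfspace_ge)

lemma convex_secondary_cone: "convex (secondary_cone A \<theta>)"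
  using convex_cone_secondary_cone by (auto simp: convex_cone_def)

text \<open>Every \<open>v\<close> in the cone of \<open>\<theta>\<close> is the limit of \<open>v + \<theta> / (n + 1)\<close>, and by
\<open>subcells_add\<close> these points are in the class of \<open>\<theta>\<close>.\<close>

lemma closure_subcells_class:
  assumes "pointed A"
  shows "closure {x. subcells A x = subcells A \<theta>} = secondary_cone A \<theta>"
proof (rule antisym)
  show "closure {x. subcells A x = subcells A \<theta>} \<subseteq> secondary_cone A \<theta>"
    by (rule closure_minimal)
      (auto simp: secondary_cone_def polyhedron_imp_closed[OF polyhedron_secondary_cone, unfolded secondary_cone_def])
  show "secondary_cone A \<theta> \<subseteq> closure {x. subcells A x = subcells A \<theta>}"
  proof
    fix v assume v: "v \<in> secondary_cone A \<theta>"
    have "subcells A (inverse (real (Suc n)) *\<^sub>R \<theta> + v) = subcells A \<theta>" for n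
      using subcells_add[OF assms, of \<theta> "inverse (real (Suc n)) *\<^sub>R \<theta>" v] v
      by (auto simp: subcells_scale secondary_cone_def)
    moreover have "(\<lambda>n. inverse (real (Suc n)) *\<^sub>R \<theta> + v) \<longlonglongrightarrow> 0 *\<^sub>R \<theta> + v"
      by (intro tendsto_intros LIMSEQ_inverse_real_of_nat)
    ultimately show "v \<in> closure {x. subcells A x = subcells A \<theta>}"
      unfolding closure_sequential by (intro exI[of _ "\<lambda>n. inverse (real (Suc n)) *\<^sub>R \<theta> + v"]) auto
  qed
qed

lemma subcells_open_segment:
  assumes "pointed A" "a \<in> secondary_cone A \<theta>" "b \<in> secondary_cone A \<theta>" "x \<in> open_segment a b"
  shows "subcells A x = subcells A a \<inter> subcells A b"
proof -
  obtain t where t: "0 < t" "t < 1" "x = (1 - t) *\<^sub>R a + t *\<^sub>R b"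
    using assms(4) by (auto simp: in_segment)
  show ?thesis unfolding t(3)
    using subcells_add[OF assms(1), of \<theta> "(1 - t) *\<^sub>R a" "t *\<^sub>R b"] assms(2,3) t
    by (simp add: subcells_scale secondary_cone_def)
qed

text \<open>If an interior point of a segment in the cone of \<open>\<theta>\<close> lies in the cone of \<open>\<phi>\<close>, then every cell for
\<open>\<phi>\<close> lies in a cell for that point, hence, by the intersection formula for subcells, in
a cell for each of the two ends.\<close>

lemma secondary_cone_Int_face:
  assumes "pointed A"
  shows "(secondary_cone A \<theta> \<inter> secondary_cone A \<phi>) face_of secondary_cone A \<theta>"
  unfolding face_of_def
proof (intro conjI ballI impI)
  show "convex (secondary_cone A \<theta> \<inter> secondary_cone A \<phi>)"
    by (intro convex_Int convex_secondary_cone)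
  fix a b x
  assume ab: "a \<in> secondary_cone A \<theta>" "b \<in> secondary_cone A \<theta>"
    and x: "x \<in> secondary_cone A \<theta> \<inter> secondary_cone A \<phi>" "x \<in> open_segment a b"
  have "subcells A x = subcells A a \<inter> subcells A b"
    using subcells_open_segment[OF assms ab x(2)] .
  thus "a \<in> secondary_cone A \<theta> \<inter> secondary_cone A \<phi>" "b \<in> secondary_cone A \<theta> \<inter> secondary_cone A \<phi>"
    using ab x(1) by (auto simp: secondary_cone_def)
qed simp

text \<open>A costless move from \<open>\<sigma>\<close> leads to another optimal vector for \<open>v\<close>, whose support is in a cell for
\<open>v\<close> and thus for \<open>x\<close>; optimality of both ends for \<open>x\<close> makes the move costless for \<open>x\<close>.\<close>

lemma cost_zero_on_secondary_cone:
  fixes A :: "int ^ 'n::finite ^ 'd"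
  assumes "x \<in> secondary_cone A v" "\<sigma> \<in> subcells A v"
    and c: "c \<in> lattice_of A" "\<And>i. i \<notin> \<sigma> \<Longrightarrow> 0 \<le> c $ i" and "cost v c = 0"
  shows "cost x c = 0"
proof -
  define s :: "int ^ 'n" where "s = (\<chi> i. if i \<in> \<sigma> then 1 else 0)"
  have supp_s: "supp s = \<sigma>" by (auto simp: s_def split: if_splits)
  have s0: "0 \<le> s $ i" for i by (simp add: s_def)
  obtain N where N: "0 < N" "\<And>i. 0 \<le> (N *s s + c) $ i"
    using nonneg_multiple[OF s0, of c] c(2) unfolding supp_s by blast
  define w where "w = N *s s"
  have w: "supp w = \<sigma>" "\<And>i. 0 \<le> w $ i"
    using N(1) supp_s s0 by (auto simp: w_def supp_smult)
  have "supp (w + c) \<in> subcells A v"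
  proof (rule subcells_of_cost_le)
    show "supp w \<in> subcells A v" using assms(2) w by simp
  qed (use N(2) c(1) assms(5) in \<open>auto simp: w_def cost_add_right\<close>)
  hence "supp (w + c) \<in> subcells A x" using assms(1) by (auto simp: secondary_cone_def)
  moreover have "w - (w + c) \<in> lattice_of A" using lattice_uminus[OF c(1)] by simp
  ultimately have "cost x (w + c) \<le> cost x w"
    by (rule subcells_cost_le[OF _ order_refl w(2)])
  moreover have "0 \<le> cost x c"
    using assms(1,2) c by (auto simp: secondary_cone_def intro: subcellsD)
  ultimately show ?thesis by (simp add: cost_add_right)
qed

text \<open>An inequality of the larger cone that is tight at \<open>v\<close> is tight on the whole cone of \<open>v\<close>, in
particular at \<open>x\<close>, and the finitely many others hold near \<open>v\<close>. So from \<open>v\<close> one can move a little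
away from \<open>x\<close> inside the larger cone.\<close>

lemma secondary_cone_prolong:
  assumes v: "v \<in> secondary_cone A \<theta>" and x: "x \<in> secondary_cone A v"
  obtains t where "0 < t" "t < 1" "v - t *\<^sub>R x \<in> secondary_cone A \<theta>"
proof -
  let ?B = "{c. is_circuit A c \<and> (\<exists>\<sigma>\<in>subcells A \<theta>. \<forall>i. i \<notin> \<sigma> \<longrightarrow> 0 \<le> c $ i)}"
  have "eventually (\<lambda>t. 0 \<le> cost (v - t *\<^sub>R x) c) (at_right 0)" if c: "c \<in> ?B" for c
  proof -
    from c obtain \<sigma> where c: "c \<in> lattice_of A" and \<sigma>: "\<sigma> \<in> subcells A \<theta>" "\<And>i. i \<notin> \<sigma> \<Longrightarrow> 0 \<le> c $ i"
      using is_circuitD(1) by blast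
    have \<sigma>v: "\<sigma> \<in> subcells A v" using \<sigma>(1) v by (auto simp: secondary_cone_def)
    hence "0 \<le> cost v c" using c \<sigma>(2) by (auto intro: subcellsD)
    show ?thesis
    proof (cases "cost v c = 0")
      case True
      thus ?thesis using cost_zero_on_secondary_cone[OF x \<sigma>v c \<sigma>(2)]
        by (simp add: cost_diff_left cost_scale_left)
    next
      case False
      have "((\<lambda>t. cost v c - t * cost x c) \<longlongrightarrow> cost v c - 0 * cost x c) (at_right 0)"
        by (intro tendsto_intros)
      hence "eventually (\<lambda>t. 0 < cost v c - t * cost x c) (at_right 0)"
        using False \<open>0 \<le> cost v c\<close> by (intro order_tendstoD(1)) auto
      thus ?thesis
        by (rule eventually_mono) (simp add: cost_diff_left cost_scale_left)
    qed
  qed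
  hence "eventually (\<lambda>t. \<forall>c\<in>?B. 0 \<le> cost (v - t *\<^sub>R x) c) (at_right 0)"
    by (intro eventually_ball_finite) (auto simp: finite_circuits)
  moreover have "eventually (\<lambda>t. t \<in> {0<..<1::real}) (at_right 0)"
    by (rule eventually_at_right_real) simp
  ultimately have "eventually (\<lambda>t. t \<in> {0<..<1} \<and> v - t *\<^sub>R x \<in> secondary_cone A \<theta>) (at_right 0)"
    by eventually_elim (auto simp: secondary_cone_halfspaces)
  then obtain t where "t \<in> {0<..<1}" "v - t *\<^sub>R x \<in> secondary_cone A \<theta>"
    using eventually_happens trivial_limit_at_right_real by blast
  thus ?thesis using that by auto
qed

text \<open>A face is the cone of any point \<open>v\<close> of its relative interior. The cone of \<open>v\<close> is itself a face, and
it meets the relative interior of \<open>D\<close>, which gives one inclusion. For the other, a point of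
the cone of \<open>v\<close> is an end of a segment through \<open>v\<close> inside the large cone, so it belongs to
the face \<open>D\<close>.\<close>

lemma face_of_secondary_cone:
  assumes "pointed A" and D: "D face_of secondary_cone A \<theta>" "D \<noteq> {}"
  shows "\<exists>v. D = secondary_cone A v"
proof -
  have "convex D" using D(1) by (rule face_of_imp_convex)
  then obtain v where v: "v \<in> rel_interior D"
    using D(2) rel_interior_eq_empty by blast
  hence vD: "v \<in> D" using rel_interior_subset by blast
  have sub: "D \<subseteq> secondary_cone A \<theta>" using D(1) by (rule face_of_imp_subset)
  have v\<theta>: "v \<in> secondary_cone A \<theta>" using vD sub by blast
  have "(secondary_cone A \<theta> \<inter> secondary_cone A v) face_of secondary_cone A \<theta>"
    by (rule secondary_cone_Int_face[OF assms(1)])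
  hence "D \<subseteq> secondary_cone A \<theta> \<inter> secondary_cone A v"
    using sub by (rule subset_of_face_of) (use v v\<theta> in auto)
  moreover have "secondary_cone A v \<subseteq> D"
  proof
    fix x assume x: "x \<in> secondary_cone A v"
    obtain t where t: "0 < t" "t < 1" "v - t *\<^sub>R x \<in> secondary_cone A \<theta>"
      using secondary_cone_prolong[OF v\<theta> x] .
    define y where "y = (1 / (1 - t)) *\<^sub>R (v - t *\<^sub>R x)"
    have y: "y \<in> secondary_cone A \<theta>"
      unfolding y_def using t by (intro convex_cone_scaleR[OF convex_cone_secondary_cone]) auto
    have v_eq: "v = (1 - t) *\<^sub>R y + t *\<^sub>R x" using t by (simp add: y_def)
    show "x \<in> D"
    proof (cases "x = y")
      case True
      hence "v = x" unfolding v_eq by (simp flip: scaleR_left_distrib)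
      thus ?thesis using vD by simp
    next
      case False
      hence "v \<in> open_segment y x" using t v_eq by (auto simp: in_segment)
      thus ?thesis
        using face_ofD[OF D(1) _ y _ vD] x secondary_cone_subset[OF v\<theta>] by blast
    qed
  qed
  ultimately show ?thesis by blast
qed

lemma is_fan_secondary_cones:
  assumes "pointed A"
  shows "is_fan (range (secondary_cone A))"
  unfolding is_fan_def
proof (intro conjI ballI allI impI)
  fix C assume "C \<in> range (secondary_cone A)"
  thus "polyhedral_cone C"
    by (auto simp: polyhedral_cone_def polyhedron_secondary_cone convex_cone_secondary_cone)
next
  fix C D assume "C \<in> range (secondary_cone A)" "D face_of C \<and> D \<noteq> {}"
  thus "D \<in> range (secondary_cone A)" using face_of_secondary_cone[OF assms] by blast
next
  fix C D assume "C \<in> range (secondary_cone A)" "D \<in> range (secondary_cone A)"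
  thus "(C \<inter> D) face_of C" "(C \<inter> D) face_of D"
    using secondary_cone_Int_face[OF assms] by (auto, metis Int_commute)
qed

section \<open>Prime ideals and radicals\<close>

text \<open>Ideals of a commutative ring are the submodules of the ring over itself, so
\<open>ideal.subspace\<close> is the predicate of being an ideal and \<open>ideal.span\<close> the generated ideal.\<close>

interpretation ideal: module "(*) :: 'a::comm_ring_1 \<Rightarrow> 'a \<Rightarrow> 'a"
  by unfold_locales (auto simp: algebra_simps)

(* As a simplification rule for a ring it would undo mult.assoc. *)
declare ideal.scale_scale [simp del]

lemma ideal_gen_eq_span: "ideal_gen B = ideal.span B"
  by (simp add: ideal_gen_def ideal.span_explicit)

definition prime_ideal :: "'a::comm_ring_1 set \<Rightarrow> bool" where
  "prime_ideal P \<longleftrightarrow> ideal.subspace P \<and> 1 \<notin> P \<and> (\<forall>x y. x * y \<in> P \<longrightarrow> x \<in> P \<or> y \<in> P)"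

lemma prime_idealD:
  assumes "prime_ideal P"
  shows "ideal.subspace P" "1 \<notin> P" "x * y \<in> P \<Longrightarrow> x \<in> P \<or> y \<in> P"
  using assms by (auto simp: prime_ideal_def)

lemma prime_ideal_mult_iff: "prime_ideal P \<Longrightarrow> x * y \<in> P \<longleftrightarrow> x \<in> P \<or> y \<in> P"
  using prime_idealD(3) ideal.subspace_scale[OF prime_idealD(1)] by (metis mult.commute)

lemma prime_ideal_power: "prime_ideal P \<Longrightarrow> x ^ m \<in> P \<Longrightarrow> x \<in> P"
  by (induction m) (auto simp: prime_ideal_mult_iff prime_idealD(2))

lemma prime_ideal_prod_iff:
  assumes "prime_ideal P" "finite S"
  shows "(\<Prod>i\<in>S. f i) \<in> P \<longleftrightarrow> (\<exists>i\<in>S. f i \<in> P)"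
  using assms(2)
  by (induction S rule: finite_induct)
    (auto simp: prime_ideal_mult_iff[OF assms(1)] prime_idealD(2)[OF assms(1)])

text \<open>An ideal that is maximal among those containing \<open>I\<close> and avoiding all positive powers of \<open>f\<close> is prime: if
it contained neither \<open>x\<close> nor \<open>y\<close>, then adjoining either one would capture a power of
\<open>f\<close>, and the product of these two powers would lie in the ideal as soon as \<open>x * y\<close> does.\<close>

lemma exists_prime_ideal_avoiding:
  assumes I: "ideal.subspace I" and f: "\<And>m. 0 < m \<Longrightarrow> f ^ m \<notin> I"
  shows "\<exists>P. prime_ideal P \<and> I \<subseteq> P \<and> f \<notin> P"
proof -
  define \<A> where "\<A> = {J. ideal.subspace J \<and> I \<subseteq> J \<and> (\<forall>m>0. f ^ m \<notin> J)}"
  have "\<exists>M\<in>\<A>. \<forall>X\<in>\<A>. M \<subseteq> X \<longrightarrow> X = M"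
  proof (rule subset_Zorn_nonempty)
    show "\<A> \<noteq> {}" using I f by (auto simp: \<A>_def)
    fix C assume C: "C \<noteq> {}" "subset.chain \<A> C"
    hence sub: "J \<in> \<A>" if "J \<in> C" for J using that by (auto simp: subset.chain_def)
    have "ideal.subspace (\<Union>C)"
    proof (rule ideal.subspaceI)
      show "0 \<in> \<Union>C" using C(1) sub by (auto simp: \<A>_def intro: ideal.subspace_0)
      show "x + y \<in> \<Union>C" if xy: "x \<in> \<Union>C" "y \<in> \<Union>C" for x y
      proof -
        obtain J K where JK: "J \<in> C" "K \<in> C" "x \<in> J" "y \<in> K" using xy by blast
        hence "J \<subseteq> K \<or> K \<subseteq> J" using C(2) by (auto simp: subset.chain_def)
        then obtain L where "L \<in> C" "x \<in> L" "y \<in> L" using JK by blast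
        thus ?thesis using sub[of L] by (auto simp: \<A>_def intro: ideal.subspace_add)
      qed
      show "c * x \<in> \<Union>C" if "x \<in> \<Union>C" for c x
        using that sub by (auto simp: \<A>_def intro: ideal.subspace_scale)
    qed
    thus "\<Union>C \<in> \<A>" using C(1) sub by (auto simp: \<A>_def)
  qed
  then obtain M where M: "M \<in> \<A>" and max: "\<And>X. X \<in> \<A> \<Longrightarrow> M \<subseteq> X \<Longrightarrow> X = M" by blast
  have Ms: "ideal.subspace M" and IM: "I \<subseteq> M" and fM: "\<And>m. 0 < m \<Longrightarrow> f ^ m \<notin> M"
    using M by (auto simp: \<A>_def)
  have grow: "\<exists>m a r. 0 < m \<and> a \<in> M \<and> f ^ m = a + r * x" if "x \<notin> M" for x
  proof -
    define J where "J = {a + r * x | a r. a \<in> M}"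
    have "ideal.subspace J"
    proof (rule ideal.subspaceI)
      show "0 \<in> J"
        unfolding J_def using ideal.subspace_0[OF Ms] by (intro CollectI exI[of _ 0]) auto
      show "y + z \<in> J" if "y \<in> J" "z \<in> J" for y z
      proof -
        obtain a r b s where "y = a + r * x" "z = b + s * x" "a \<in> M" "b \<in> M"
          using \<open>y \<in> J\<close> \<open>z \<in> J\<close> by (auto simp: J_def)
        thus ?thesis unfolding J_def using ideal.subspace_add[OF Ms]
          by (intro CollectI exI[of _ "a + b"] exI[of _ "r + s"]) (auto simp: algebra_simps)
      qed
      show "c * y \<in> J" if "y \<in> J" for c y
      proof -
        obtain a r where y: "y = a + r * x" "a \<in> M" using \<open>y \<in> J\<close> by (auto simp: J_def)
        have "c * y = c * a + (c * r) * x"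
          unfolding y(1) by (simp only: distrib_left mult.assoc)
        moreover have "c * a \<in> M" using y(2) by (rule ideal.subspace_scale[OF Ms])
        ultimately show ?thesis unfolding J_def by blast
      qed
    qed
    moreover have "M \<subseteq> J"
    proof
      fix a assume "a \<in> M"
      thus "a \<in> J" unfolding J_def by (intro CollectI exI[of _ a] exI[of _ 0]) simp
    qed
    moreover have "x \<in> J"
      unfolding J_def using ideal.subspace_0[OF Ms] by (intro CollectI exI[of _ 0] exI[of _ 1]) auto
    ultimately have "J \<notin> \<A>" using max that by blast
    thus ?thesis using \<open>ideal.subspace J\<close> \<open>M \<subseteq> J\<close> IM by (auto simp: \<A>_def J_def)
  qed
  have "x \<in> M \<or> y \<in> M" if xy: "x * y \<in> M" for x y
  proof (rule ccontr)
    assume "\<not> (x \<in> M \<or> y \<in> M)"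
    then obtain m a r n b s where "0 < m" "a \<in> M" "f ^ m = a + r * x"
        and "0 < n" "b \<in> M" "f ^ n = b + s * y"
      using grow by meson
    have "f ^ (m + n) = (b + s * y) * a + (r * x) * b + (r * s) * (x * y)"
      unfolding power_add \<open>f ^ m = _\<close> \<open>f ^ n = _\<close> by (simp add: algebra_simps)
    also have "\<dots> \<in> M"
      by (intro ideal.subspace_add[OF Ms] ideal.subspace_scale[OF Ms \<open>a \<in> M\<close>]
          ideal.subspace_scale[OF Ms \<open>b \<in> M\<close>] ideal.subspace_scale[OF Ms xy])
    finally show False using fM[of "m + n"] \<open>0 < m\<close> by simp
  qed
  moreover have "f \<notin> M" using fM[of 1] by simp
  moreover have "1 \<notin> M" using ideal.subspace_scale[OF Ms, of 1 f] \<open>f \<notin> M\<close> by auto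
  ultimately show ?thesis using Ms IM unfolding prime_ideal_def by blast
qed

text \<open>The radical is the intersection of the primes above the generators. All statements about radicals
below are reduced to statements about primes by this equivalence.\<close>

lemma radical_ideal_gen_iff:
  "f \<in> radical_ideal (ideal_gen B) \<longleftrightarrow> (\<forall>P. prime_ideal P \<and> B \<subseteq> P \<longrightarrow> f \<in> P)"
proof
  assume "f \<in> radical_ideal (ideal_gen B)"
  then obtain m where m: "f ^ m \<in> ideal.span B"
    by (auto simp: radical_ideal_def ideal_gen_eq_span)
  show "\<forall>P. prime_ideal P \<and> B \<subseteq> P \<longrightarrow> f \<in> P"
    using m ideal.span_minimal prime_idealD(1) prime_ideal_power by blast
next
  assume *: "\<forall>P. prime_ideal P \<and> B \<subseteq> P \<longrightarrow> f \<in> P"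
  show "f \<in> radical_ideal (ideal_gen B)"
  proof (rule ccontr)
    assume "f \<notin> radical_ideal (ideal_gen B)"
    hence "f ^ m \<notin> ideal.span B" if "0 < m" for m
      using that unfolding radical_ideal_def ideal_gen_eq_span by blast
    from exists_prime_ideal_avoiding[OF ideal.subspace_span this] show False
      using * ideal.span_superset by blast
  qed
qed

lemma radical_ideal_gen_subset:
  assumes "\<And>P g. prime_ideal P \<Longrightarrow> B' \<subseteq> P \<Longrightarrow> g \<in> B \<Longrightarrow> g \<in> P"
  shows "radical_ideal (ideal_gen B) \<subseteq> radical_ideal (ideal_gen B')"
  using assms unfolding radical_ideal_gen_iff subset_iff by blast

section \<open>Monomials and initial forms\<close>

abbreviation monomial :: "(nat ^ 'n) \<Rightarrow> ('k::comm_ring_1, 'n) polyring" where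
  "monomial a \<equiv> Poly_Mapping.single a 1"

abbreviation variable :: "'n::finite \<Rightarrow> ('k::comm_ring_1, 'n) polyring" where
  "variable i \<equiv> monomial (axis i 1)"

definition int_vec :: "nat ^ 'n \<Rightarrow> int ^ 'n" where
  "int_vec a = (\<chi> i. int (a $ i))"

lemma int_vec_nth [simp]: "int_vec a $ i = int (a $ i)"
  by (simp add: int_vec_def)

lemma int_vec_add: "int_vec (a + b) = int_vec a + int_vec b"
  by (simp add: vec_eq_iff)

lemma weight_eq_cost: "weight \<omega> a = cost \<omega> (int_vec a)"
  by (simp add: weight_def cost_def inner_vec_def)

lemma weight_add: "weight \<omega> (a + b) = weight \<omega> a + weight \<omega> b"
  by (simp add: weight_eq_cost int_vec_add cost_add_right)

lemma weight_0: "weight \<omega> 0 = 0"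
  by (simp add: weight_def)

lemma sum_axis: "(\<Sum>i\<in>UNIV. axis i (a $ i)) = (a :: nat ^ 'n::finite)"
  by (simp add: vec_eq_iff axis_def)

lemma monomial_eq_prod: "(monomial a :: ('k::comm_ring_1, 'n::finite) polyring) = (\<Prod>i\<in>UNIV. variable i ^ (a $ i))"
proof -
  have pow: "variable i ^ k = (monomial (axis i k) :: ('k, 'n) polyring)" for i :: 'n and k
  proof (induction k)
    case 0
    have "axis i 0 = (0 :: nat ^ 'n)" by (simp add: vec_eq_iff axis_def)
    thus ?case by (simp only: power_0 single_one)
  next
    case (Suc k)
    have "axis i 1 + axis i k = (axis i (Suc k) :: nat ^ 'n)" by (simp add: vec_eq_iff axis_def)
    thus ?case by (simp only: power_Suc Suc mult_single mult_1_left)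
  qed
  have "(\<Prod>i\<in>S. monomial (axis i (a $ i))) = (monomial (\<Sum>i\<in>S. axis i (a $ i)) :: ('k, 'n) polyring)"
    if "finite S" for S
    using that by (induction S rule: finite_induct) (simp_all add: mult_single)
  from this[of UNIV] show ?thesis by (simp only: pow sum_axis finite)
qed

lemma monomial_mem_prime_iff:
  assumes "prime_ideal P"
  shows "(monomial a :: ('k::comm_ring_1, 'n::finite) polyring) \<in> P \<longleftrightarrow> (\<exists>i. a $ i \<noteq> 0 \<and> variable i \<in> P)"
proof -
  have *: "variable i ^ k \<in> P \<longleftrightarrow> k \<noteq> 0 \<and> variable i \<in> P" for i k
    by (induction k) (auto simp: prime_ideal_mult_iff[OF assms] prime_idealD(2)[OF assms])
  show ?thesis
    by (subst monomial_eq_prod) (simp only: prime_ideal_prod_iff[OF assms finite] * bex_UNIV)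
qed

lemma sum_monomials: "f = (\<Sum>a\<in>Poly_Mapping.keys f. Poly_Mapping.single a (Poly_Mapping.lookup f a))"
  by (rule poly_mapping_eqI)
    (simp add: lookup_sum lookup_single when_def in_keys_iff)

lemma single_eq_scaled_monomial: "Poly_Mapping.single a c = Poly_Mapping.single 0 c * monomial a"
  by (simp add: mult_single)

lemma lookup_initial_form:
  "Poly_Mapping.lookup (initial_form \<omega> f) a =
     (if \<forall>v\<in>Poly_Mapping.keys f. weight \<omega> v \<le> weight \<omega> a then Poly_Mapping.lookup f a else 0)"
  by (simp add: initial_form_def lookup_sum lookup_single when_def in_keys_iff)

lemma keys_initial_form:
  "Poly_Mapping.keys (initial_form \<omega> f) =
     {a \<in> Poly_Mapping.keys f. \<forall>v\<in>Poly_Mapping.keys f. weight \<omega> v \<le> weight \<omega> a}"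
  by (auto simp: in_keys_iff lookup_initial_form split: if_splits)

lemma initial_form_0 [simp]: "initial_form \<omega> 0 = 0"
  by (simp add: initial_form_def)

lemma initial_form_eqI:
  assumes g: "\<And>a. a \<in> Poly_Mapping.keys g \<Longrightarrow> weight \<omega> a = D"
    and h: "\<And>a. a \<in> Poly_Mapping.keys h \<Longrightarrow> weight \<omega> a < D" and "g \<noteq> 0"
  shows "initial_form \<omega> (g + h) = g"
proof (rule poly_mapping_eqI)
  fix a
  have disj: "Poly_Mapping.lookup h b = 0" if "weight \<omega> b = D" for b
    using h[of b] that by (auto simp: in_keys_iff)
  have disj': "Poly_Mapping.lookup g b = 0" if "weight \<omega> b \<noteq> D" for b
    using g[of b] that by (auto simp: in_keys_iff)
  obtain b where b: "Poly_Mapping.lookup g b \<noteq> 0"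
    using \<open>g \<noteq> 0\<close> by (metis lookup_zero poly_mapping_eqI)
  hence bD: "weight \<omega> b = D" using disj' by blast
  hence bk: "b \<in> Poly_Mapping.keys (g + h)"
    using b disj by (simp add: in_keys_iff lookup_add)
  have le: "weight \<omega> v \<le> D" if "v \<in> Poly_Mapping.keys (g + h)" for v
    using g[of v] h[of v] subsetD[OF keys_add that] by auto
  show "Poly_Mapping.lookup (initial_form \<omega> (g + h)) a = Poly_Mapping.lookup g a"
  proof (cases "weight \<omega> a = D")
    case True
    thus ?thesis using le disj by (auto simp: lookup_initial_form lookup_add)
  next
    case False
    have "Poly_Mapping.lookup (initial_form \<omega> (g + h)) a = 0"
    proof (rule ccontr)
      assume "Poly_Mapping.lookup (initial_form \<omega> (g + h)) a \<noteq> 0"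
      hence "a \<in> Poly_Mapping.keys (initial_form \<omega> (g + h))" by (simp add: in_keys_iff)
      hence "weight \<omega> a \<le> D" "D \<le> weight \<omega> a"
        using le bk bD by (auto simp: keys_initial_form)
      thus False using False by simp
    qed
    thus ?thesis using disj'[OF False] by simp
  qed
qed

lemma initial_form_split:
  assumes "f \<noteq> 0"
  shows "\<exists>D. (\<forall>a\<in>Poly_Mapping.keys (initial_form \<omega> f). weight \<omega> a = D) \<and>
             (\<forall>a\<in>Poly_Mapping.keys (f - initial_form \<omega> f). weight \<omega> a < D)"
proof (intro exI conjI ballI)
  let ?D = "Max (weight \<omega> ` Poly_Mapping.keys f)"
  have ne: "Poly_Mapping.keys f \<noteq> {}"
    using assms by (metis empty_iff in_keys_iff lookup_zero poly_mapping_eqI)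
  hence "?D \<in> weight \<omega> ` Poly_Mapping.keys f" by (intro Max_in) auto
  then obtain b where b: "b \<in> Poly_Mapping.keys f" "?D = weight \<omega> b" by blast
  have le: "weight \<omega> v \<le> ?D" if "v \<in> Poly_Mapping.keys f" for v
    using that by (intro Max_ge) auto
  show "weight \<omega> a = ?D" if "a \<in> Poly_Mapping.keys (initial_form \<omega> f)" for a
    using that le[of a] b by (force simp: keys_initial_form)
  show "weight \<omega> a < ?D" if a: "a \<in> Poly_Mapping.keys (f - initial_form \<omega> f)" for a
  proof -
    have "a \<in> Poly_Mapping.keys f" "weight \<omega> a \<noteq> ?D"
      using a le by (auto simp: in_keys_iff lookup_minus lookup_initial_form split: if_splits)
    thus ?thesis using le by (simp add: order.strict_iff_order)
  qed
qed

text \<open>The part of \<open>f ^ m\<close> of weight \<open>m * D\<close>, where \<open>D\<close> is the top weight of \<open>f\<close>, is the \<open>m\<close>-th power of the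
initial form of \<open>f\<close>. Either it is nonzero, and then it is the initial form of \<open>f ^ m\<close>, or it is zero
and lies in every ideal.\<close>

lemma initial_form_power_mem:
  assumes "f ^ m \<in> I"
  shows "initial_form \<omega> f ^ m \<in> ideal.span (initial_form \<omega> ` I)"
proof (cases "f = 0")
  case True
  hence "initial_form \<omega> (f ^ m) = initial_form \<omega> f ^ m"
  proof (cases m)
    case 0
    have "initial_form \<omega> (1 + 0) = (1 :: ('b, 'a) polyring)"
      by (rule initial_form_eqI[of _ _ 0]) (auto simp: weight_0)
    thus ?thesis using 0 by simp
  qed auto
  thus ?thesis using assms by (metis ideal.span_base imageI)
next
  case False
  define g h where "g = initial_form \<omega> f" and "h = f - initial_form \<omega> f"
  have f_eq: "f = g + h" by (simp add: g_def h_def)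
  obtain D where g: "\<forall>a\<in>Poly_Mapping.keys g. weight \<omega> a = D"
    and h: "\<forall>a\<in>Poly_Mapping.keys h. weight \<omega> a < D"
    using initial_form_split[OF False] unfolding g_def h_def by blast
  have "\<exists>h'. f ^ m = g ^ m + h' \<and> (\<forall>a\<in>Poly_Mapping.keys (g ^ m). weight \<omega> a = real m * D) \<and>
          (\<forall>a\<in>Poly_Mapping.keys h'. weight \<omega> a < real m * D)" for m
  proof (induction m)
    case 0
    show ?case by (intro exI[of _ 0]) (auto simp: weight_0)
  next
    case (Suc m)
    then obtain h' where eq: "f ^ m = g ^ m + h'"
      and gm: "\<And>a. a \<in> Poly_Mapping.keys (g ^ m) \<Longrightarrow> weight \<omega> a = real m * D"
      and hm: "\<And>a. a \<in> Poly_Mapping.keys h' \<Longrightarrow> weight \<omega> a < real m * D" by blast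
    have "f ^ Suc m = (g + h) * (g ^ m + h')"
      by (simp only: power_Suc eq f_eq[symmetric])
    also have "\<dots> = g ^ Suc m + (g * h' + h * g ^ m + h * h')"
      by (simp add: distrib_left distrib_right add.assoc)
    finally have "f ^ Suc m = g ^ Suc m + (g * h' + h * g ^ m + h * h')" .
    moreover have "weight \<omega> a = real (Suc m) * D" if a: "a \<in> Poly_Mapping.keys (g ^ Suc m)" for a
    proof -
      have "a \<in> {x + y |x y. x \<in> Poly_Mapping.keys g \<and> y \<in> Poly_Mapping.keys (g ^ m)}"
        using subsetD[OF keys_mult a[unfolded power_Suc]] .
      thus ?thesis using g gm by (auto simp: weight_add distrib_right)
    qed
    moreover have "weight \<omega> a < real (Suc m) * D"
      if a: "a \<in> Poly_Mapping.keys (g * h' + h * g ^ m + h * h')" for a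
    proof -
      have "a \<in> Poly_Mapping.keys (g * h') \<union> Poly_Mapping.keys (h * g ^ m) \<union> Poly_Mapping.keys (h * h')"
        using subsetD[OF keys_add a] subsetD[OF keys_add, of a "g * h'" "h * g ^ m"] by blast
      then consider x y where "a = x + y" "x \<in> Poly_Mapping.keys g" "y \<in> Poly_Mapping.keys h'"
        | x y where "a = x + y" "x \<in> Poly_Mapping.keys h" "y \<in> Poly_Mapping.keys (g ^ m)"
        | x y where "a = x + y" "x \<in> Poly_Mapping.keys h" "y \<in> Poly_Mapping.keys h'"
        using subsetD[OF keys_mult, of a g h'] subsetD[OF keys_mult, of a h "g ^ m"]
          subsetD[OF keys_mult, of a h h'] by blast
      thus ?thesis
        by cases (use g h gm hm in \<open>force simp: weight_add distrib_right\<close>)+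
    qed
    ultimately show ?case by blast
  qed
  then obtain h' where h': "f ^ m = g ^ m + h'" "\<And>a. a \<in> Poly_Mapping.keys (g ^ m) \<Longrightarrow> weight \<omega> a = real m * D"
    "\<And>a. a \<in> Poly_Mapping.keys h' \<Longrightarrow> weight \<omega> a < real m * D" by blast
  show ?thesis
  proof (cases "g ^ m = 0")
    case True
    thus ?thesis by (simp add: g_def ideal.span_zero)
  next
    case F: False
    have "initial_form \<omega> (f ^ m) = g ^ m"
      unfolding h'(1) by (rule initial_form_eqI[OF h'(2,3) F])
    thus ?thesis using assms by (metis g_def ideal.span_base imageI)
  qed
qed

section \<open>The toric ideal is contained in the radical of the circuit ideal\<close>

lemma pos_part_neq_0_iff: "pos_part u $ i \<noteq> 0 \<longleftrightarrow> 0 < u $ i"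
  by (auto simp: pos_part_def)

lemma neg_part_neq_0_iff: "neg_part u $ i \<noteq> 0 \<longleftrightarrow> u $ i < 0"
  by (auto simp: neg_part_def)

lemma pos_part_minus_neg_part: "int (pos_part u $ i) - int (neg_part u $ i) = u $ i"
  by (simp add: pos_part_def neg_part_def max_def)

lemma int_vec_pos_neg: "int_vec (pos_part u) - int_vec (neg_part u) = u"
  by (simp add: vec_eq_iff pos_part_minus_neg_part)

lemma binomial_of_0 [simp]: "binomial_of 0 = 0"
  by (simp add: binomial_of_def pos_part_def neg_part_def)

lemma binomial_of_uminus: "binomial_of (- u) = - binomial_of u"
  by (simp add: binomial_of_def pos_part_def neg_part_def)

text \<open>Modulo an ideal in which the multiplier on the left is cancellable, this identity shows that the
exponents whose binomials vanish form a subgroup.\<close>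

lemma binomial_of_diff:
  fixes u v :: "int ^ 'n::finite"
  shows "monomial (neg_part u + pos_part v) * binomial_of (u - v) =
     (monomial (neg_part (u - v)) *
       (monomial (neg_part v) * binomial_of u - monomial (neg_part u) * binomial_of v)
       :: ('k::comm_ring_1, 'n) polyring)"
proof -
  have "neg_part u + pos_part v + pos_part (u - v) = neg_part (u - v) + (neg_part v + pos_part u)"
    unfolding vec_eq_iff
  proof
    fix i
    show "(neg_part u + pos_part v + pos_part (u - v)) $ i = (neg_part (u - v) + (neg_part v + pos_part u)) $ i"
      using pos_part_minus_neg_part[of u i] pos_part_minus_neg_part[of v i]
        pos_part_minus_neg_part[of "u - v" i] by simp
  qed
  moreover have "neg_part v + neg_part u = neg_part u + neg_part v"
    by (rule add.commute)
  ultimately show ?thesis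
    by (simp add: binomial_of_def right_diff_distrib mult_single ac_simps)
qed

text \<open>Let \<open>S\<close> index the variables outside \<open>P\<close>. If \<open>supp u \<subseteq> S\<close>, the vectors supported in \<open>S\<close> whose
binomials lie in \<open>P\<close> form a group containing the circuits supported in \<open>S\<close>, hence \<open>u\<close>.
Otherwise some variable in \<open>P\<close> divides one of the two monomials, say the negative one. If the
positive one were not in \<open>P\<close>, a circuit conformal to \<open>u\<close> and using that variable would have its
negative monomial in \<open>P\<close> and its positive one outside, although their difference is in \<open>P\<close>.\<close>

lemma binomial_of_mem_prime:
  fixes A :: "int ^ 'n::finite ^ 'd"
  assumes P: "prime_ideal P" "(circuit_ideal A :: ('k::comm_ring_1, 'n) polyring set) \<subseteq> P"
    and u: "u \<in> lattice_of A"
  shows "(binomial_of u :: ('k, 'n) polyring) \<in> P"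
proof -
  have Ps: "ideal.subspace P" using P(1) by (rule prime_idealD)
  have circ: "binomial_of c \<in> P" if "is_circuit A c" for c
    using P(2) that by (auto simp: circuit_ideal_def ideal_gen_eq_span intro: ideal.span_base)
  define S where "S = {i. (variable i :: ('k, 'n) polyring) \<notin> P}"
  have mono: "monomial a \<in> P \<longleftrightarrow> (\<exists>i. a $ i \<noteq> 0 \<and> i \<notin> S)" for a
    by (subst monomial_mem_prime_iff[OF P(1)]) (simp add: S_def)
  have mono_pos: "monomial (pos_part v) \<in> P \<longleftrightarrow> (\<exists>i. 0 < v $ i \<and> i \<notin> S)" for v
    by (simp only: mono pos_part_neq_0_iff)
  have mono_neg: "monomial (neg_part v) \<in> P \<longleftrightarrow> (\<exists>i. v $ i < 0 \<and> i \<notin> S)" for v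
    by (simp only: mono neg_part_neq_0_iff)
  show ?thesis
  proof (cases "supp u \<subseteq> S")
    case True
    define G where "G = {v. supp v \<subseteq> S \<and> binomial_of v \<in> P}"
    have "u \<in> G"
    proof (rule circuits_generate_lattice[OF _ _ _ u True])
      show "0 \<in> G" using ideal.subspace_0[OF Ps] by (auto simp: G_def)
      show "c \<in> G" if "is_circuit A c" "supp c \<subseteq> S" for c
        using that circ by (simp add: G_def)
      fix v w assume vw: "v \<in> G" "w \<in> G"
      have "monomial (neg_part v + pos_part w) * binomial_of (v - w) \<in> P"
        unfolding binomial_of_diff using vw
        by (intro ideal.subspace_scale[OF Ps] ideal.subspace_diff[OF Ps]) (auto simp: G_def)
      moreover have "monomial (neg_part v + pos_part w) \<notin> P"
      proof -
        have "monomial (neg_part v) \<notin> P" "monomial (pos_part w) \<notin> P"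
          using vw by (auto simp: mono_neg mono_pos G_def subset_iff)
        thus ?thesis
          using prime_ideal_mult_iff[OF P(1), of "monomial (neg_part v)" "monomial (pos_part w)"]
          by (simp add: mult_single)
      qed
      moreover have "supp (v - w) \<subseteq> S"
        using vw by (fastforce simp: G_def)
      ultimately show "v - w \<in> G"
        by (auto simp: G_def prime_ideal_mult_iff[OF P(1)])
    qed
    thus ?thesis by (simp add: G_def)
  next
    case False
    then obtain j where j: "u $ j \<noteq> 0" "j \<notin> S" unfolding subset_iff mem_supp by blast
    have neg: "binomial_of v \<in> P" if v: "v \<in> lattice_of A" "v $ j < 0" for v
    proof -
      have "monomial (neg_part v) \<in> P"
        using j v unfolding mono_neg by blast
      moreover have "monomial (pos_part v) \<in> P"
      proof (rule ccontr)
        assume notin: "monomial (pos_part v) \<notin> P"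
        obtain c where c: "is_circuit A c" "conformal c v" "c $ j \<noteq> 0"
          using conformal_circuit[OF v(1), of j] v(2) by auto
        have "c $ j < 0"
          using c(2,3) v(2) unfolding conformal_def by (metis not_less_iff_gr_or_eq zero_less_mult_iff)
        hence "monomial (neg_part c) \<in> P"
          using j unfolding mono_neg by blast
        moreover have "monomial (pos_part c) = binomial_of c + monomial (neg_part c)"
          by (simp add: binomial_of_def)
        ultimately have "monomial (pos_part c) \<in> P"
          using circ[OF c(1)] ideal.subspace_add[OF Ps] by metis
        then obtain i where i: "0 < c $ i" "i \<notin> S" unfolding mono_pos by blast
        hence "0 < v $ i" using c(2) unfolding conformal_def
          by (metis less_irrefl less_asym zero_less_mult_iff)
        thus False using notin i(2) unfolding mono_pos by blast
      qed
      ultimately show ?thesis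
        unfolding binomial_of_def by (rule ideal.subspace_diff[OF Ps, rotated])
    qed
    show ?thesis
    proof (cases "u $ j < 0")
      case True
      thus ?thesis using neg u by blast
    next
      case F: False
      hence "binomial_of (- u) \<in> P" using neg[of "- u"] j(1) u by (simp add: lattice_uminus)
      thus ?thesis using ideal.subspace_neg[OF Ps] by (metis binomial_of_uminus minus_minus)
    qed
  qed
qed

lemma circuit_ideal_subset_toric_ideal:
  "(circuit_ideal A :: ('k::comm_ring_1, 'n::finite) polyring set) \<subseteq> toric_ideal A"
  unfolding circuit_ideal_def toric_ideal_def ideal_gen_eq_span
  by (intro ideal.span_mono image_mono) (auto simp: is_circuitD(1))

lemma toric_ideal_subset_radical:
  "(toric_ideal A :: ('k::comm_ring_1, 'n::finite) polyring set) \<subseteq> radical_ideal (circuit_ideal A)"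
proof
  fix f :: "('k, 'n) polyring" assume f: "f \<in> toric_ideal A"
  have "f \<in> P" if P: "prime_ideal P" "binomial_of ` {c. is_circuit A c} \<subseteq> P" for P
  proof -
    have "circuit_ideal A \<subseteq> P"
      unfolding circuit_ideal_def ideal_gen_eq_span
      by (intro ideal.span_minimal P prime_idealD(1))
    hence "binomial_of ` lattice_of A \<subseteq> P"
      using binomial_of_mem_prime[OF P(1)] by blast
    hence "toric_ideal A \<subseteq> P"
      unfolding toric_ideal_def ideal_gen_eq_span
      by (intro ideal.span_minimal P prime_idealD(1))
    thus ?thesis using f by blast
  qed
  thus "f \<in> radical_ideal (circuit_ideal A)"
    unfolding circuit_ideal_def radical_ideal_gen_iff by blast
qed

text \<open>Every \<open>f\<close> in the toric ideal has a power \<open>f ^ m\<close> in the circuit ideal, and then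
\<open>initial_form \<omega> f ^ m\<close> lies in the initial ideal of the circuit ideal.\<close>

lemma radical_initial_circuit_ideal:
  "radical_ideal (initial_ideal \<omega> (circuit_ideal A :: ('k::comm_ring_1, 'n::finite) polyring set)) =
     radical_ideal (initial_ideal \<omega> (toric_ideal A))"
  unfolding initial_ideal_def
proof (rule antisym; rule radical_ideal_gen_subset)
  fix P :: "('k, 'n) polyring set" and g :: "('k, 'n) polyring"
  assume "initial_form \<omega> ` toric_ideal A \<subseteq> P" "g \<in> initial_form \<omega> ` circuit_ideal A"
  thus "g \<in> P" using circuit_ideal_subset_toric_ideal[of A] by blast
next
  fix P :: "('k, 'n) polyring set" and g :: "('k, 'n) polyring"
  assume P: "prime_ideal P" "initial_form \<omega> ` circuit_ideal A \<subseteq> P"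
    and "g \<in> initial_form \<omega> ` toric_ideal A"
  then obtain f where f: "f \<in> toric_ideal A" "g = initial_form \<omega> f" by blast
  then obtain m where "f ^ m \<in> circuit_ideal A"
    using toric_ideal_subset_radical[of A] by (auto simp: radical_ideal_def)
  hence "g ^ m \<in> ideal.span (initial_form \<omega> ` circuit_ideal A)"
    unfolding f(2) by (rule initial_form_power_mem)
  also have "\<dots> \<subseteq> P"
    by (intro ideal.span_minimal P prime_idealD(1))
  finally show "g \<in> P" by (rule prime_ideal_power[OF P(1)])
qed

section \<open>Initial ideals of the toric ideal and regular subdivisions\<close>

text \<open>The ring homomorphism that acts as \<open>\<iota>\<close> on coefficients and as \<open>\<psi>\<close> on monomials. It is used twice:
for the grading by the columns of \<open>A\<close>, and for evaluation at a point with coordinates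
\<open>0\<close> and \<open>1\<close>.\<close>

definition evaluate :: "('k \<Rightarrow> 'r) \<Rightarrow> ('m \<Rightarrow> 'r) \<Rightarrow> ('m \<Rightarrow>\<^sub>0 'k::zero) \<Rightarrow> 'r::comm_ring_1" where
  "evaluate \<iota> \<psi> f = (\<Sum>a\<in>Poly_Mapping.keys f. \<iota> (Poly_Mapping.lookup f a) * \<psi> a)"

locale evaluation =
  fixes \<iota> :: "'k::comm_ring_1 \<Rightarrow> 'r::comm_ring_1" and \<psi> :: "'m::comm_monoid_add \<Rightarrow> 'r"
  assumes \<iota>_add: "\<iota> (c + d) = \<iota> c + \<iota> d" and \<iota>_mult: "\<iota> (c * d) = \<iota> c * \<iota> d"
    and \<psi>_add: "\<psi> (a + b) = \<psi> a * \<psi> b"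
begin

lemma \<iota>_0: "\<iota> 0 = 0"
  using \<iota>_add[of 0 0] by simp

lemma evaluate_superset:
  "finite S \<Longrightarrow> Poly_Mapping.keys f \<subseteq> S \<Longrightarrow>
     evaluate \<iota> \<psi> f = (\<Sum>a\<in>S. \<iota> (Poly_Mapping.lookup f a) * \<psi> a)"
  unfolding evaluate_def by (rule sum.mono_neutral_left) (auto simp: in_keys_iff \<iota>_0)

lemma evaluate_single: "evaluate \<iota> \<psi> (Poly_Mapping.single a c) = \<iota> c * \<psi> a"
  by (subst evaluate_superset[of "{a}"]) auto

lemma evaluate_0: "evaluate \<iota> \<psi> 0 = 0"
  by (simp add: evaluate_def)

lemma evaluate_add: "evaluate \<iota> \<psi> (f + g) = evaluate \<iota> \<psi> f + evaluate \<iota> \<psi> g"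
proof -
  let ?S = "Poly_Mapping.keys f \<union> Poly_Mapping.keys g"
  have "evaluate \<iota> \<psi> (f + g) = (\<Sum>a\<in>?S. \<iota> (Poly_Mapping.lookup (f + g) a) * \<psi> a)"
    by (rule evaluate_superset) (use keys_add[of f g] in auto)
  thus ?thesis
    by (simp add: evaluate_superset[of ?S] lookup_add \<iota>_add distrib_right sum.distrib)
qed

lemma evaluate_sum: "evaluate \<iota> \<psi> (\<Sum>x\<in>X. F x) = (\<Sum>x\<in>X. evaluate \<iota> \<psi> (F x))"
  by (induction X rule: infinite_finite_induct) (auto simp: evaluate_0 evaluate_add)

lemma evaluate_mult: "evaluate \<iota> \<psi> (f * g) = evaluate \<iota> \<psi> f * evaluate \<iota> \<psi> g"
proof -
  have "f * g = (\<Sum>a\<in>Poly_Mapping.keys f. \<Sum>b\<in>Poly_Mapping.keys g.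
          Poly_Mapping.single (a + b) (Poly_Mapping.lookup f a * Poly_Mapping.lookup g b))"
    by (subst (1) sum_monomials[of f], subst (1) sum_monomials[of g])
      (simp add: sum_product mult_single)
  hence "evaluate \<iota> \<psi> (f * g) = (\<Sum>a\<in>Poly_Mapping.keys f. \<Sum>b\<in>Poly_Mapping.keys g.
          \<iota> (Poly_Mapping.lookup f a) * \<iota> (Poly_Mapping.lookup g b) * (\<psi> a * \<psi> b))"
    by (simp only: evaluate_sum evaluate_single \<iota>_mult \<psi>_add)
  thus ?thesis by (simp add: evaluate_def sum_product ac_simps)
qed

lemma subspace_evaluate_kernel: "ideal.subspace {f. evaluate \<iota> \<psi> f = 0}"
  by (rule ideal.subspaceI) (simp_all add: evaluate_0 evaluate_add evaluate_mult)

lemma evaluate_power: "\<psi> 0 = 1 \<Longrightarrow> \<iota> 1 = 1 \<Longrightarrow> evaluate \<iota> \<psi> (f ^ m) = evaluate \<iota> \<psi> f ^ m"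
  using evaluate_single[of 0 1] by (induction m) (simp_all add: evaluate_mult)

end

text \<open>The homomorphism \<open>x\<^sup>a \<mapsto> t\<^sup>A\<^sup>a\<close> into Laurent polynomials kills the binomials of the lattice,
and its coefficient at \<open>e\<close> is the sum of the coefficients over the fibre of \<open>e\<close>.\<close>

lemma toric_fiber_sum:
  fixes f :: "('k::comm_ring_1, 'n::finite) polyring" and A :: "int ^ 'n ^ 'd"
  assumes "f \<in> toric_ideal A"
  shows "(\<Sum>a | a \<in> Poly_Mapping.keys f \<and> A *v int_vec a = e. Poly_Mapping.lookup f a) = 0"
proof -
  define \<iota> :: "'k \<Rightarrow> (int ^ 'd) \<Rightarrow>\<^sub>0 'k" where "\<iota> = Poly_Mapping.single 0"
  define \<psi> :: "nat ^ 'n \<Rightarrow> (int ^ 'd) \<Rightarrow>\<^sub>0 'k" where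
    "\<psi> a = Poly_Mapping.single (A *v int_vec a) 1" for a
  interpret evaluation \<iota> \<psi>
    by unfold_locales
      (simp_all add: \<iota>_def \<psi>_def single_add mult_single int_vec_add matrix_vector_right_distrib)
  have "binomial_of u \<in> {f. evaluate \<iota> \<psi> f = 0}" if "u \<in> lattice_of A" for u
  proof -
    have "A *v int_vec (pos_part u) - A *v int_vec (neg_part u) = A *v u"
      by (simp only: matrix_vector_mult_diff_distrib[symmetric] int_vec_pos_neg)
    hence "A *v int_vec (pos_part u) = A *v int_vec (neg_part u)"
      using that by (simp add: lattice_of_def)
    hence eq: "evaluate \<iota> \<psi> (monomial (pos_part u)) = evaluate \<iota> \<psi> (monomial (neg_part u))"
      by (simp add: evaluate_single \<psi>_def)
    have "monomial (pos_part u) = binomial_of u + (monomial (neg_part u) :: ('k, 'n) polyring)"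
      by (simp add: binomial_of_def)
    from arg_cong[OF this, of "evaluate \<iota> \<psi>"] eq show ?thesis
      by (simp add: evaluate_add)
  qed
  hence "toric_ideal A \<subseteq> {f. evaluate \<iota> \<psi> f = 0}"
    unfolding toric_ideal_def ideal_gen_eq_span
    by (intro ideal.span_minimal subspace_evaluate_kernel) blast
  hence "Poly_Mapping.lookup (evaluate \<iota> \<psi> f) e = 0" using assms by auto
  thus ?thesis
    by (simp add: evaluate_def \<iota>_def \<psi>_def mult_single lookup_sum lookup_single when_def
        sum.If_cases Int_def conj_commute)
qed

lemma toric_closed_sum:
  fixes f :: "('k::comm_ring_1, 'n::finite) polyring" and A :: "int ^ 'n ^ 'd"
  assumes f: "f \<in> toric_ideal A" and K: "K \<subseteq> Poly_Mapping.keys f"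
    and closed: "\<And>a b. a \<in> K \<Longrightarrow> b \<in> Poly_Mapping.keys f \<Longrightarrow> int_vec b - int_vec a \<in> lattice_of A \<Longrightarrow> b \<in> K"
  shows "(\<Sum>a\<in>K. Poly_Mapping.lookup f a) = 0"
proof -
  let ?h = "\<lambda>a. A *v int_vec a"
  have "finite K" using K by (rule finite_subset) simp
  hence "(\<Sum>a\<in>K. Poly_Mapping.lookup f a) =
          (\<Sum>e\<in>?h ` K. \<Sum>a | a \<in> K \<and> ?h a = e. Poly_Mapping.lookup f a)"
    by (rule sum.image_gen)
  also have "\<dots> = (\<Sum>e\<in>?h ` K. \<Sum>a | a \<in> Poly_Mapping.keys f \<and> ?h a = e. Poly_Mapping.lookup f a)"
  proof (rule sum.cong[OF refl])
    fix e assume "e \<in> ?h ` K"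
    then obtain a where a: "a \<in> K" "e = ?h a" by blast
    have "b \<in> K" if "b \<in> Poly_Mapping.keys f" "?h b = e" for b
      using closed[OF a(1) that(1)] that(2) a(2)
      by (simp add: lattice_of_def matrix_vector_mult_diff_distrib)
    hence "{b. b \<in> K \<and> ?h b = e} = {b. b \<in> Poly_Mapping.keys f \<and> ?h b = e}"
      using K by blast
    thus "(\<Sum>a | a \<in> K \<and> ?h a = e. Poly_Mapping.lookup f a) =
            (\<Sum>a | a \<in> Poly_Mapping.keys f \<and> ?h a = e. Poly_Mapping.lookup f a)" by simp
  qed
  also have "\<dots> = 0" by (simp add: toric_fiber_sum[OF f])
  finally show ?thesis .
qed

lemma monomial_diff_in_toric_ideal:
  assumes "int_vec a - int_vec b \<in> lattice_of A"
  shows "monomial a - monomial b \<in> (toric_ideal A :: ('k::comm_ring_1, 'n::finite) polyring set)"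
proof -
  define u where "u = int_vec a - int_vec b"
  define m :: "nat ^ 'n" where "m = (\<chi> i. min (a $ i) (b $ i))"
  have "m + pos_part u = a" "m + neg_part u = b"
    by (auto simp: vec_eq_iff m_def u_def pos_part_def neg_part_def)
  hence "monomial a - monomial b = (monomial m * binomial_of u :: ('k, 'n) polyring)"
    by (simp add: binomial_of_def right_diff_distrib mult_single)
  also have "\<dots> \<in> toric_ideal A"
    unfolding toric_ideal_def ideal_gen_eq_span using assms
    by (intro ideal.span_scale ideal.span_base) (simp add: u_def)
  finally show ?thesis .
qed

lemma subcells_weight_le:
  assumes "supp (int_vec a) \<in> subcells A \<omega>" "int_vec b - int_vec a \<in> lattice_of A"
  shows "weight \<omega> a \<le> weight \<omega> b"
  unfolding weight_eq_cost
  by (rule subcells_cost_le[OF assms(1) order_refl _ assms(2)]) simp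

lemma subcells_of_weight_le:
  assumes "supp (int_vec a) \<in> subcells A \<omega>" "int_vec b - int_vec a \<in> lattice_of A"
    and "weight \<omega> b \<le> weight \<omega> a"
  shows "supp (int_vec b) \<in> subcells A \<omega>"
  by (rule subcells_of_cost_le[OF assms(1) _ assms(2)]) (use assms(3) in \<open>simp_all add: weight_eq_cost\<close>)

definition indicator_vec :: "'n set \<Rightarrow> nat ^ 'n" where
  "indicator_vec \<sigma> = (\<chi> i. if i \<in> \<sigma> then 1 else 0)"

lemma indicator_vec_mem_prime:
  assumes "prime_ideal P"
  shows "(monomial (indicator_vec \<sigma>) :: ('k::comm_ring_1, 'n::finite) polyring) \<in> P \<longleftrightarrow>
           (\<exists>i\<in>\<sigma>. variable i \<in> P)"
  by (subst monomial_mem_prime_iff[OF assms]) (auto simp: indicator_vec_def)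

text \<open>If \<open>\<sigma>\<close> is not in a cell, a lattice vector \<open>u\<close> with negative part supported in \<open>\<sigma>\<close> has negative cost,
so the negative monomial is the initial form of the binomial of \<open>u\<close>; every prime containing it
contains a variable indexed by \<open>\<sigma>\<close>.\<close>

lemma not_subcell_imp_radical:
  fixes A :: "int ^ 'n::finite ^ 'd"
  assumes "\<sigma> \<notin> subcells A \<omega>"
  shows "(monomial (indicator_vec \<sigma>) :: ('k::comm_ring_1, 'n) polyring)
           \<in> radical_ideal (initial_ideal \<omega> (toric_ideal A))"
  unfolding initial_ideal_def radical_ideal_gen_iff
proof (intro allI impI)
  fix P :: "('k, 'n) polyring set"
  assume P: "prime_ideal P \<and> initial_form \<omega> ` toric_ideal A \<subseteq> P"
  obtain u where u: "u \<in> lattice_of A" "\<And>i. i \<notin> \<sigma> \<Longrightarrow> 0 \<le> u $ i" "cost \<omega> u < 0"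
    using assms by (auto simp: subcells_def not_le)
  have "cost \<omega> u = weight \<omega> (pos_part u) - weight \<omega> (neg_part u)"
    using int_vec_pos_neg[of u] cost_diff_right by (metis weight_eq_cost)
  hence less: "weight \<omega> (pos_part u) < weight \<omega> (neg_part u)" using u(3) by simp
  have "binomial_of (- u) = monomial (neg_part u) + (- monomial (pos_part u) :: ('k, 'n) polyring)"
    unfolding binomial_of_uminus by (simp add: binomial_of_def)
  moreover have "initial_form \<omega> (monomial (neg_part u) + (- monomial (pos_part u) :: ('k, 'n) polyring)) =
      monomial (neg_part u)"
  proof (rule initial_form_eqI)
    show "weight \<omega> a < weight \<omega> (neg_part u)" if "a \<in> Poly_Mapping.keys (- monomial (pos_part u) :: ('k, 'n) polyring)" for a
      using that less by (auto simp: in_keys_iff lookup_single when_def split: if_splits)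
    show "monomial (neg_part u) \<noteq> (0 :: ('k, 'n) polyring)"
      by (metis lookup_single_eq lookup_zero zero_neq_one)
  qed auto
  moreover have "(binomial_of (- u) :: ('k, 'n) polyring) \<in> toric_ideal A"
    unfolding toric_ideal_def ideal_gen_eq_span
    by (intro ideal.span_base imageI lattice_uminus u)
  ultimately have "(monomial (neg_part u) :: ('k, 'n) polyring) \<in> P"
    using P by (metis image_subset_iff)
  then obtain i where i: "u $ i < 0" "(variable i :: ('k, 'n) polyring) \<in> P"
    using monomial_mem_prime_iff[of P "neg_part u"] P unfolding neg_part_neq_0_iff by blast
  hence "i \<in> \<sigma>" using u(2)[of i] by force
  thus "(monomial (indicator_vec \<sigma>) :: ('k, 'n) polyring) \<in> P"
    using indicator_vec_mem_prime[of P \<sigma>] P i(2) by blast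
qed

text \<open>If a costless move from a cell \<open>\<tau>\<close> had a positive coordinate \<open>j\<close> outside \<open>\<tau>\<close>, adding enough
copies of it would turn any move from \<open>insert j \<tau>\<close> into a move from \<open>\<tau>\<close>, so
\<open>insert j \<tau>\<close> would be in a cell as well.\<close>

lemma maximal_subcell_closed:
  fixes A :: "int ^ 'n::finite ^ 'd"
  assumes \<tau>: "\<tau> \<in> subcells A \<omega>" and max: "\<And>\<rho>. \<rho> \<in> subcells A \<omega> \<Longrightarrow> \<tau> \<subseteq> \<rho> \<Longrightarrow> \<rho> = \<tau>"
    and u: "u \<in> lattice_of A" "\<And>i. i \<notin> \<tau> \<Longrightarrow> 0 \<le> u $ i" "cost \<omega> u = 0"
  shows "supp u \<subseteq> \<tau>"
proof
  fix j assume j: "j \<in> supp u"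
  show "j \<in> \<tau>"
  proof (rule ccontr)
    assume "j \<notin> \<tau>"
    hence uj: "1 \<le> u $ j" using u(2)[of j] j by force
    have "insert j \<tau> \<in> subcells A \<omega>"
      unfolding subcells_def
    proof (intro CollectI ballI impI)
      fix z assume z: "z \<in> lattice_of A" "\<forall>i. i \<notin> insert j \<tau> \<longrightarrow> 0 \<le> z $ i"
      have "0 \<le> cost \<omega> (\<bar>z $ j\<bar> *s u + z)"
      proof (rule subcellsD[OF \<tau>])
        show "\<bar>z $ j\<bar> *s u + z \<in> lattice_of A"
          by (intro lattice_add lattice_smult u z)
        fix i assume i: "i \<notin> \<tau>"
        show "0 \<le> (\<bar>z $ j\<bar> *s u + z) $ i"
        proof (cases "i = j")
          case True
          have "\<bar>z $ j\<bar> * 1 \<le> \<bar>z $ j\<bar> * u $ j" using uj by (intro mult_left_mono) auto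
          thus ?thesis using True by simp
        next
          case False
          thus ?thesis using z(2) i u(2)[OF i] by simp
        qed
      qed
      thus "0 \<le> cost \<omega> z" using u(3) by (simp add: cost_add_right cost_smult_right)
    qed
    thus False using max[of "insert j \<tau>"] \<open>j \<notin> \<tau>\<close> by blast
  qed
qed

text \<open>Extend \<open>\<sigma>\<close> to a maximal cell \<open>\<tau>\<close> and evaluate at the point whose coordinates are \<open>1\<close> on \<open>\<tau>\<close> and
\<open>0\<close> elsewhere. The monomial of \<open>\<sigma>\<close> has value \<open>1\<close>. The value of the initial form of an element \<open>f\<close> of the
toric ideal is \<open>0\<close>: if a term of it is supported in \<open>\<tau>\<close>, its exponent is cheapest in its fibre and
also heaviest among the exponents of \<open>f\<close>, so all terms of \<open>f\<close> in that fibre have this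
weight, are supported in the maximal cell \<open>\<tau>\<close>, and have coefficients adding up to zero.\<close>

lemma subcell_imp_not_radical:
  fixes A :: "int ^ 'n::finite ^ 'd"
  assumes \<sigma>: "\<sigma> \<in> subcells A \<omega>"
  shows "(monomial (indicator_vec \<sigma>) :: ('k::comm_ring_1, 'n) polyring)
           \<notin> radical_ideal (initial_ideal \<omega> (toric_ideal A))"
proof -
  obtain \<tau> where \<tau>: "\<tau> \<in> subcells A \<omega>" "\<sigma> \<subseteq> \<tau>" and max: "\<And>\<rho>. \<rho> \<in> subcells A \<omega> \<Longrightarrow> \<tau> \<subseteq> \<rho> \<Longrightarrow> \<rho> = \<tau>"
    using finite_has_maximal2[OF _ \<sigma>] by (metis finite_code)
  define \<psi> :: "nat ^ 'n \<Rightarrow> 'k" where "\<psi> a = (if supp (int_vec a) \<subseteq> \<tau> then 1 else 0)" for a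
  interpret evaluation "\<lambda>c. c" \<psi>
  proof
    have "supp (int_vec (a + b)) = supp (int_vec a) \<union> supp (int_vec b)" for a b :: "nat ^ 'n"
      by (auto simp: supp_def)
    thus "\<psi> (a + b) = \<psi> a * \<psi> b" for a b by (simp add: \<psi>_def)
  qed auto
  have "evaluate (\<lambda>c. c) \<psi> (initial_form \<omega> f) = 0" if f: "f \<in> toric_ideal A" for f
  proof -
    let ?g = "initial_form \<omega> f"
    define K where "K = {a \<in> Poly_Mapping.keys ?g. supp (int_vec a) \<subseteq> \<tau>}"
    have "evaluate (\<lambda>c. c) \<psi> ?g = (\<Sum>a\<in>Poly_Mapping.keys ?g. if supp (int_vec a) \<subseteq> \<tau> then Poly_Mapping.lookup ?g a else 0)"
      unfolding evaluate_def by (rule sum.cong) (auto simp: \<psi>_def)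
    also have "\<dots> = (\<Sum>a\<in>K. Poly_Mapping.lookup ?g a)"
      unfolding K_def by (rule sum.inter_filter[symmetric]) simp
    also have "\<dots> = (\<Sum>a\<in>K. Poly_Mapping.lookup f a)"
      by (rule sum.cong) (auto simp: K_def keys_initial_form lookup_initial_form)
    also have "\<dots> = 0"
    proof (rule toric_closed_sum[OF f])
      show "K \<subseteq> Poly_Mapping.keys f" by (auto simp: K_def keys_initial_form)
      fix a b assume a: "a \<in> K" and b: "b \<in> Poly_Mapping.keys f" "int_vec b - int_vec a \<in> lattice_of A"
      have a\<tau>: "supp (int_vec a) \<subseteq> \<tau>" and top: "\<And>v. v \<in> Poly_Mapping.keys f \<Longrightarrow> weight \<omega> v \<le> weight \<omega> a"
        using a by (auto simp: K_def keys_initial_form)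
      have "weight \<omega> a \<le> weight \<omega> b"
        by (rule subcells_weight_le[OF subcells_mono[OF \<tau>(1) a\<tau>] b(2)])
      hence eq: "weight \<omega> b = weight \<omega> a" using top[OF b(1)] by simp
      have "supp (int_vec b - int_vec a) \<subseteq> \<tau>"
      proof (rule maximal_subcell_closed[OF \<tau>(1) max b(2)])
        show "0 \<le> (int_vec b - int_vec a) $ i" if "i \<notin> \<tau>" for i
        proof -
          have "int_vec a $ i = 0" using that a\<tau> by (metis mem_supp subsetD)
          thus ?thesis by simp
        qed
        show "cost \<omega> (int_vec b - int_vec a) = 0"
          using eq by (simp add: cost_diff_right weight_eq_cost)
      qed auto
      moreover have "supp (int_vec b) \<subseteq> supp (int_vec b - int_vec a) \<union> supp (int_vec a)"
        by (auto simp: supp_def)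
      ultimately have "supp (int_vec b) \<subseteq> \<tau>" using a\<tau> by blast
      thus "b \<in> K" using b(1) top eq by (auto simp: K_def keys_initial_form)
    qed
    finally show ?thesis .
  qed
  hence "ideal.span (initial_form \<omega> ` toric_ideal A) \<subseteq> {f. evaluate (\<lambda>c. c) \<psi> f = 0}"
    by (intro ideal.span_minimal subspace_evaluate_kernel) auto
  moreover have "evaluate (\<lambda>c. c) \<psi> (monomial (indicator_vec \<sigma>) ^ m) = 1" for m
  proof -
    have "evaluate (\<lambda>c. c) \<psi> (monomial (indicator_vec \<sigma>)) = 1"
      using \<tau>(2) by (auto simp: evaluate_single \<psi>_def indicator_vec_def subset_iff)
    moreover have "\<psi> 0 = 1" by (auto simp: \<psi>_def)
    ultimately show ?thesis by (simp add: evaluate_power)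
  qed
  ultimately show ?thesis
    by (auto simp: radical_ideal_def initial_ideal_def ideal_gen_eq_span)
qed

lemma monomial_in_radical_iff:
  "(monomial (indicator_vec \<sigma>) :: ('k::comm_ring_1, 'n::finite) polyring)
      \<in> radical_ideal (initial_ideal \<omega> (toric_ideal A)) \<longleftrightarrow> \<sigma> \<notin> subcells A \<omega>"
  using not_subcell_imp_radical[of \<sigma> A \<omega>] subcell_imp_not_radical[of \<sigma> A \<omega>] by blast

text \<open>The initial form for \<open>\<phi>\<close> is treated fibre by fibre. If none of its exponents in a fibre has
its support in a cell, all these monomials lie in \<open>P\<close>. Otherwise, as the terms of the initial form have maximal
weight while exponents supported in a cell have minimal weight in their fibre, the fibre part
consists of all terms of \<open>f\<close> in this fibre, all supported in cells, hence all of one weight for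
\<open>\<omega>\<close> too. Being of coefficient sum zero, it is a combination of binomials that are their own
initial forms for \<open>\<omega>\<close>.\<close>

lemma initial_form_mem_prime_of_subcells_eq:
  fixes A :: "int ^ 'n::finite ^ 'd" and f :: "('k::comm_ring_1, 'n) polyring"
  assumes eq: "subcells A \<phi> = subcells A \<omega>"
    and P: "prime_ideal P" "initial_form \<omega> ` toric_ideal A \<subseteq> P"
    and f: "f \<in> toric_ideal A"
  shows "initial_form \<phi> f \<in> P"
proof -
  let ?g = "initial_form \<phi> f" and ?h = "\<lambda>a. A *v int_vec a"
  have Ps: "ideal.subspace P" using P(1) by (rule prime_idealD)
  have fiber: "int_vec b - int_vec a \<in> lattice_of A" if "?h a = ?h b" for a b
    using that by (simp add: lattice_of_def matrix_vector_mult_diff_distrib)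
  have part: "(\<Sum>a | a \<in> Poly_Mapping.keys ?g \<and> ?h a = e. Poly_Mapping.single a (Poly_Mapping.lookup ?g a)) \<in> P"
    (is "sum _ ?K \<in> P") for e
  proof (cases "\<exists>a\<in>?K. supp (int_vec a) \<in> subcells A \<phi>")
    case True
    then obtain a0 where a0: "a0 \<in> ?K" "supp (int_vec a0) \<in> subcells A \<phi>" by blast
    have top: "weight \<phi> b \<le> weight \<phi> a0" if "b \<in> Poly_Mapping.keys f" for b
      using that a0 by (auto simp: keys_initial_form)
    have K: "b \<in> ?K" "weight \<omega> b = weight \<omega> a0" if b: "b \<in> Poly_Mapping.keys f" "?h b = e" for b
    proof -
      have lat: "int_vec b - int_vec a0 \<in> lattice_of A" "int_vec a0 - int_vec b \<in> lattice_of A"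
        using a0(1) b(2) by (auto intro: fiber)
      have le: "weight \<phi> b \<le> weight \<phi> a0" using top b(1) .
      moreover have "weight \<phi> a0 \<le> weight \<phi> b"
        by (rule subcells_weight_le[OF a0(2) lat(1)])
      ultimately have "weight \<phi> b = weight \<phi> a0" by simp
      thus "b \<in> ?K" using top b by (simp add: keys_initial_form)
      have "supp (int_vec b) \<in> subcells A \<phi>"
        by (rule subcells_of_weight_le[OF a0(2) lat(1) le])
      thus "weight \<omega> b = weight \<omega> a0"
        using a0(2) lat unfolding eq by (intro antisym subcells_weight_le)
    qed
    have lookup: "Poly_Mapping.lookup ?g a = Poly_Mapping.lookup f a" if "a \<in> ?K" for a
      using that by (auto simp: keys_initial_form lookup_initial_form)
    have "(\<Sum>a\<in>?K. Poly_Mapping.lookup f a) = 0"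
    proof (rule toric_closed_sum[OF f])
      show "?K \<subseteq> Poly_Mapping.keys f" by (auto simp: keys_initial_form)
      fix a b assume "a \<in> ?K" and b: "b \<in> Poly_Mapping.keys f" "int_vec b - int_vec a \<in> lattice_of A"
      hence "?h b = e" by (simp add: lattice_of_def matrix_vector_mult_diff_distrib)
      thus "b \<in> ?K" using K(1) b(1) by blast
    qed
    hence "Poly_Mapping.lookup (\<Sum>a\<in>?K. Poly_Mapping.single a0 (Poly_Mapping.lookup f a)) x =
             Poly_Mapping.lookup (0 :: ('k, 'n) polyring) x" for x
      by (cases "x = a0") (simp_all add: lookup_sum lookup_single when_def)
    hence "(\<Sum>a\<in>?K. Poly_Mapping.single a0 (Poly_Mapping.lookup f a)) = (0 :: ('k, 'n) polyring)"
      by (rule poly_mapping_eqI)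
    hence "(\<Sum>a\<in>?K. Poly_Mapping.single a (Poly_Mapping.lookup ?g a)) =
             (\<Sum>a\<in>?K. Poly_Mapping.single 0 (Poly_Mapping.lookup f a) * (monomial a - monomial a0))"
      by (simp add: right_diff_distrib sum_subtractf mult_single lookup)
    also have "\<dots> \<in> P"
    proof (intro ideal.subspace_sum[OF Ps] ideal.subspace_scale[OF Ps])
      fix a assume a: "a \<in> ?K"
      hence af: "a \<in> Poly_Mapping.keys f" "?h a = e" by (auto simp: keys_initial_form)
      show "monomial a - monomial a0 \<in> P"
      proof (cases "a = a0")
        case True
        thus ?thesis by (simp add: ideal.subspace_0[OF Ps])
      next
        case False
        have "initial_form \<omega> ((monomial a - monomial a0) + 0) = (monomial a - monomial a0 :: ('k, 'n) polyring)"
        proof (rule initial_form_eqI)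
          show "weight \<omega> b = weight \<omega> a0" if "b \<in> Poly_Mapping.keys (monomial a - monomial a0 :: ('k, 'n) polyring)" for b
            using that K(2)[OF af] by (auto simp: in_keys_iff lookup_minus lookup_single when_def split: if_splits)
          have "Poly_Mapping.lookup (monomial a - monomial a0 :: ('k, 'n) polyring) a = 1"
            using False by (simp add: lookup_minus lookup_single when_def)
          thus "monomial a - monomial a0 \<noteq> (0 :: ('k, 'n) polyring)"
            by (metis lookup_zero zero_neq_one)
        qed simp
        moreover have "monomial a - monomial a0 \<in> toric_ideal A"
          using a0(1) af by (intro monomial_diff_in_toric_ideal fiber) auto
        ultimately show ?thesis using P(2) by (metis add.right_neutral image_subset_iff)
      qed
    qed
    finally show ?thesis .
  next
    case False
    show ?thesis
    proof (rule ideal.subspace_sum[OF Ps])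
      fix a assume "a \<in> ?K"
      hence "supp (int_vec a) \<notin> subcells A \<omega>" using False eq by blast
      hence "monomial (indicator_vec (supp (int_vec a))) \<in> P"
        using not_subcell_imp_radical[where 'k = 'k, of _ A \<omega>] P
        unfolding initial_ideal_def radical_ideal_gen_iff by blast
      then obtain i where "i \<in> supp (int_vec a)" "(variable i :: ('k, 'n) polyring) \<in> P"
        using indicator_vec_mem_prime[OF P(1)] by blast
      hence "(monomial a :: ('k, 'n) polyring) \<in> P"
        using monomial_mem_prime_iff[OF P(1), of a] by auto
      thus "Poly_Mapping.single a (Poly_Mapping.lookup ?g a) \<in> P"
        by (subst single_eq_scaled_monomial) (rule ideal.subspace_scale[OF Ps])
    qed
  qed
  have "?g = (\<Sum>a\<in>Poly_Mapping.keys ?g. Poly_Mapping.single a (Poly_Mapping.lookup ?g a))"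
    by (rule sum_monomials)
  also have "\<dots> = (\<Sum>e\<in>?h ` Poly_Mapping.keys ?g.
      \<Sum>a | a \<in> Poly_Mapping.keys ?g \<and> ?h a = e. Poly_Mapping.single a (Poly_Mapping.lookup ?g a))"
    by (rule sum.image_gen) simp
  also have "\<dots> \<in> P"
    by (intro ideal.subspace_sum[OF Ps] part)
  finally show ?thesis .
qed

lemma radical_initial_toric_ideal_eq_iff:
  "radical_ideal (initial_ideal \<phi> (toric_ideal A :: ('k::comm_ring_1, 'n::finite) polyring set)) =
     radical_ideal (initial_ideal \<omega> (toric_ideal A)) \<longleftrightarrow> subcells A \<phi> = subcells A \<omega>"
proof
  assume eq: "radical_ideal (initial_ideal \<phi> (toric_ideal A :: ('k, 'n) polyring set)) =
     radical_ideal (initial_ideal \<omega> (toric_ideal A))"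
  have "\<sigma> \<in> subcells A \<phi> \<longleftrightarrow> \<sigma> \<in> subcells A \<omega>" for \<sigma>
    using monomial_in_radical_iff[where 'k = 'k, of \<sigma> \<phi> A]
      monomial_in_radical_iff[where 'k = 'k, of \<sigma> \<omega> A] unfolding eq by blast
  thus "subcells A \<phi> = subcells A \<omega>" by blast
next
  have sub: "radical_ideal (initial_ideal \<phi> (toric_ideal A :: ('k, 'n) polyring set)) \<subseteq>
     radical_ideal (initial_ideal \<omega> (toric_ideal A))" if "subcells A \<phi> = subcells A \<omega>" for \<phi> \<omega>
    unfolding initial_ideal_def
    by (rule radical_ideal_gen_subset) (use initial_form_mem_prime_of_subcells_eq[OF that] in blast)
  assume "subcells A \<phi> = subcells A \<omega>"
  thus "radical_ideal (initial_ideal \<phi> (toric_ideal A :: ('k, 'n) polyring set)) =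
     radical_ideal (initial_ideal \<omega> (toric_ideal A))"
    using sub[of \<phi> \<omega>] sub[of \<omega> \<phi>] by simp
qed

section \<open>The radical equivalence classes\<close>

lemma radical_equiv_toric_ideal:
  "radical_equiv (toric_ideal A :: ('k::comm_ring_1, 'n::finite) polyring set) =
     {(u, v). subcells A u = subcells A v}"
  by (simp add: radical_equiv_def radical_initial_toric_ideal_eq_iff)

lemma radical_equiv_circuit_ideal:
  "radical_equiv (circuit_ideal A :: ('k::comm_ring_1, 'n::finite) polyring set) =
     radical_equiv (toric_ideal A :: ('k, 'n) polyring set)"
  by (simp add: radical_equiv_def radical_initial_circuit_ideal)

lemma class_closures_toric_ideal:
  fixes A :: "int ^ 'n::finite ^ 'd"
  assumes "pointed A"
  shows "class_closures (radical_equiv (toric_ideal A :: ('k::comm_ring_1, 'n) polyring set)) =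
           range (secondary_cone A)"
proof -
  have "{(u, v). subcells A u = subcells A v} `` {\<theta>} = {x. subcells A x = subcells A \<theta>}" for \<theta>
    by auto
  hence "UNIV // {(u, v). subcells A u = subcells A v} = (\<lambda>\<theta>. {x. subcells A x = subcells A \<theta>}) ` UNIV"
    by (simp add: quotient_def UNION_singleton_eq_range)
  thus ?thesis
    by (simp add: class_closures_def radical_equiv_toric_ideal image_image closure_subcells_class[OF assms])
qed

theorem theorem5p16:
  fixes A :: "int ^ 'n::finite ^ 'd::finite"
  assumes "rank (map_matrix real_of_int A) = CARD('d)"
    and "lattice_of A \<inter> {u. \<forall>i. 0 \<le> u $ i} = {0}"
  shows "defines_fan
           (radical_equiv (circuit_ideal A :: ('k::alg_closed_field, 'n) polyring set))
           (secondary_fan TYPE('k) A)"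
  unfolding defines_fan_def secondary_fan_def radical_equiv_circuit_ideal
proof (intro conjI refl)
  show "equiv UNIV (radical_equiv (toric_ideal A :: ('k, 'n) polyring set))"
    by (rule equivI) (auto simp: radical_equiv_def refl_on_def sym_def trans_def)
  show "is_fan (class_closures (radical_equiv (toric_ideal A :: ('k, 'n) polyring set)))"
    unfolding class_closures_toric_ideal[OF assms(2)] by (rule is_fan_secondary_cones[OF assms(2)])
qed

end
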